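(* Let $R$ be a commutative ring of characteristic $2$ and $n\ge 0$. Then $\lambda:\widetilde H_n\otimes_R A\to H_n$ is an isomorphism of graded $R$-algebras, where $\widetilde H_n\otimes_R A$ carries the tensor product algebra structure. In particular $H_n\cong\widetilde H_n[x]/(x^2)$ as algebras.
   Context: Fix a commutative ring $R$. Place $2n$ points on a vertical line; $\mathfrak{C}_n$ is the set of planar crossingless matchings of these $2n$ points by $n$ disjoint arcs in one half-plane. For $a\in\mathfrak{C}_n$, $a^!$ is the reflection of $a$ across the vertical line, and $a^!b$ is the disjoint union of planar circles obtained by gluing $a^!$ and $b$ along the $2n$ points. Let $A=R[x]/(x^2)$ with comultiplication $\Delta(1)=1\otimes x+x\otimes 1$, $\Delta(x)=x\otimes x$; $\deg 1=1$, $\deg x=-1$. The arc algebra is $H_n=\bigoplus_{a,b\in\mathfrak{C}_n}A^{\otimes\pi_0(a^!b)}$ ($H_0=R$) with standard basis the pairs $(a^!b,\mathbf{v})$, $\mathbf{v}:\pi_0(a^!b)\to\{1,x\}$, of quantum degree $\#_1\mathbf{v}-\#_x\mathbf{v}-n$; its product is given by Khovanov's TQFT ($m$ for merges, $\Delta$ for splits) applied to the minimal saddle cobordism $a^!b\sqcup b^!c\to a^!c$, and products $(a^!b,\mathbf{v})(c^!d,\mathbf{v}')$ with $b\ne c$ vanish. The bottom-most point is marked; $\kappa_0$ denotes the component of $a^!b$ containing it and $\pi_*(a^!b)=\pi_0(a^!b)\setminus\{\kappa_0\}$. The reduced arc algebra $\widetilde H_n=H_n/I_x$ ($I_x$ the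 ideal spanned by basis elements with $\kappa_0$ labeled $x$) has basis $(a^!b,\mathbf{v})$ with $\mathbf{v}:\pi_*(a^!b)\to\{1,x\}$ (marked component implicitly labeled $1$), of degree $\#_1\mathbf{v}-\#_x\mathbf{v}-n-1$ (counting $\kappa_0$). For such $(a^!b,\mathbf{v})$ and $s\in\{1,x\}$, $(a^!b,\mathbf{v})_s\in H_n$ is the basis element extending $\mathbf{v}$ by $\mathbf{v}(\kappa_0)=s$; $\mathfrak{X}(a^!b,\mathbf{v})=\{\kappa\in\pi_*(a^!b):\mathbf{v}(\kappa)=x\}$; for $\kappa\in\mathfrak{X}(a^!b,\mathbf{v})$, $(a^!b,\mathbf{v}_\kappa)\in H_n$ labels $\kappa_0$ by $x$, $\kappa$ by $1$, and all other components as $\mathbf{v}$. The $R$-linear map $\lambda:\widetilde H_n\otimes_R A\to H_n$ is defined by $\lambda((a^!b,\mathbf{v})\otimes x)=(a^!b,\mathbf{v})_x$ and $\lambda((a^!b,\mathbf{v})\otimes 1)=(a^!b,\mathbf{v})_1+\sum_{\kappa\in\mathfrak{X}(a^!b,\mathbf{v})}(a^!b,\mathbf{v}_\kappa)$.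
   Formalization: Proved for n ≥ 1 only: for n = 0 there is no marked point, so κ₀, I_x and λ are undefined, and with H_0 = R the module H̃_0 ⊗ A cannot have the rank 1 of H_0; the final "in particular" isomorphism is not stated separately, being the same statement. *)

theory Defs
  imports Main
begin

text \<open>The 2n points on the vertical line are 0,...,2n-1 (bottom to top); point 0 is the
marked bottom-most point. A matching is an involution of {0..<2n} without fixed points,
extended by the identity outside {0..<2n} (so that matchings are canonical functions).\<close>

type_synonym matching = "nat \<Rightarrow> nat"

definition is_matching :: "nat \<Rightarrow> matching \<Rightarrow> bool" where
  "is_matching n m \<longleftrightarrow>
     (\<forall>i<2*n. m i < 2*n \<and> m i \<noteq> i \<and> m (m i) = i) \<and> (\<forall>i. 2*n \<le> i \<longrightarrow> m i = i)"

definition noncrossing :: "nat \<Rightarrow> matching \<Rightarrow> bool" where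
  "noncrossing n m \<longleftrightarrow>
     (\<forall>i j. i < j \<and> j < m i \<and> m i < 2*n \<longrightarrow> i < m j \<and> m j < m i)"

definition Cn :: "nat \<Rightarrow> matching set" where
  "Cn n = {m. is_matching n m \<and> noncrossing n m}"

definition glue_edges :: "nat \<Rightarrow> matching \<Rightarrow> matching \<Rightarrow> (nat \<times> nat) set" where
  "glue_edges n a b = {(i, a i) | i. i < 2*n} \<union> {(i, b i) | i. i < 2*n}"

definition circ :: "nat \<Rightarrow> matching \<Rightarrow> matching \<Rightarrow> nat \<Rightarrow> nat set" where
  "circ n a b i = {j. (i, j) \<in> (glue_edges n a b \<union> (glue_edges n a b)\<inverse>)\<^sup>*}"

text \<open>pi_0(a^! b): each circle is represented by its set of points.\<close>
definition circles :: "nat \<Rightarrow> matching \<Rightarrow> matching \<Rightarrow> nat set set" where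
  "circles n a b = circ n a b ` {0..<2*n}"

definition kappa0 :: "nat \<Rightarrow> matching \<Rightarrow> matching \<Rightarrow> nat set" where
  "kappa0 n a b = circ n a b 0"

section \<open>Labels: the basis {1, x} of A = R[x]/(x^2)\<close>

datatype lab = L1 | Lx

text \<open>Multiplication of basis elements of A: None stands for 0.\<close>
fun amul :: "lab \<Rightarrow> lab \<Rightarrow> lab option" where
  "amul L1 L1 = Some L1"
| "amul L1 Lx = Some Lx"
| "amul Lx L1 = Some Lx"
| "amul Lx Lx = None"

fun adeg :: "lab \<Rightarrow> int" where
  "adeg L1 = 1"
| "adeg Lx = -1"

text \<open>Labellings of a finite set S of components; canonically L1 outside S.\<close>
definition labs :: "'k set \<Rightarrow> ('k \<Rightarrow> lab) set" where
  "labs S = {v. \<forall>K. K \<notin> S \<longrightarrow> v K = L1}"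

type_synonym hbasis = "matching \<times> matching \<times> (nat set \<Rightarrow> lab)"

definition Hbasis :: "nat \<Rightarrow> hbasis set" where
  "Hbasis n = {(a, b, v). a \<in> Cn n \<and> b \<in> Cn n \<and> v \<in> labs (circles n a b)}"

definition H_carrier :: "nat \<Rightarrow> (hbasis \<Rightarrow> 'r::comm_ring_1) set" where
  "H_carrier n = {f. \<forall>e. e \<notin> Hbasis n \<longrightarrow> f e = 0}"

definition hdeg :: "nat \<Rightarrow> hbasis \<Rightarrow> int" where
  "hdeg n e = (case e of (a, b, v) \<Rightarrow>
      int (card {\<kappa> \<in> circles n a b. v \<kappa> = L1}) - int (card {\<kappa> \<in> circles n a b. v \<kappa> = Lx})
      - int n)"

definition delta :: "'b \<Rightarrow> 'b \<Rightarrow> 'r::comm_ring_1" where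
  "delta e = (\<lambda>e'. if e' = e then 1 else 0)"

text \<open>Intermediate diagrams: points (False,i) of the left diagram a^! b and (True,i) of the
right diagram b^! d. P is the set of endpoints of b-arcs at which the saddle has already been
performed: there the arcs of b and b^! are replaced by the two arcs (False,i)--(True,i).\<close>

definition st_edges :: "nat \<Rightarrow> matching \<Rightarrow> matching \<Rightarrow> matching \<Rightarrow> nat set
    \<Rightarrow> ((bool \<times> nat) \<times> (bool \<times> nat)) set" where
  "st_edges n a b d P =
     {((False, i), (False, a i)) | i. i < 2*n}
   \<union> {((True, i), (True, d i)) | i. i < 2*n}
   \<union> {((False, i), (True, i)) | i. i < 2*n \<and> i \<in> P}
   \<union> {((False, i), (False, b i)) | i. i < 2*n \<and> i \<notin> P}
   \<union> {((True, i), (True, b i)) | i. i < 2*n \<and> i \<notin> P}"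

definition st_comp :: "nat \<Rightarrow> matching \<Rightarrow> matching \<Rightarrow> matching \<Rightarrow> nat set
    \<Rightarrow> bool \<times> nat \<Rightarrow> (bool \<times> nat) set" where
  "st_comp n a b d P p =
     {q. (p, q) \<in> (st_edges n a b d P \<union> (st_edges n a b d P)\<inverse>)\<^sup>*}"

definition st_comps :: "nat \<Rightarrow> matching \<Rightarrow> matching \<Rightarrow> matching \<Rightarrow> nat set
    \<Rightarrow> (bool \<times> nat) set set" where
  "st_comps n a b d P = st_comp n a b d P ` (UNIV \<times> {0..<2*n})"

type_synonym slab = "(bool \<times> nat) set \<Rightarrow> lab"

text \<open>One saddle (at the b-arc through point i), applied to a basis labelling u:
Khovanov's m for a merge, Delta for a split. Result: a linear combination of labellings.\<close>
definition saddle :: "nat \<Rightarrow> matching \<Rightarrow> matching \<Rightarrow> matching \<Rightarrow> nat set \<Rightarrow> nat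
    \<Rightarrow> slab \<Rightarrow> slab \<Rightarrow> 'r::comm_ring_1" where
  "saddle n a b d P i u =
    (let P' = P \<union> {i, b i};
         L = st_comp n a b d P (False, i);
         Rt = st_comp n a b d P (True, i);
         base = (\<lambda>K. if K \<in> st_comps n a b d P' then u K else L1);
         K1 = st_comp n a b d P' (False, i);
         K2 = st_comp n a b d P' (False, b i)
     in if L \<noteq> Rt then
          (case amul (u L) (u Rt) of
             None \<Rightarrow> (\<lambda>_. 0)
           | Some s \<Rightarrow> delta (base(K1 := s)))
        else if u L = L1 then
          (\<lambda>w. delta (base(K1 := L1, K2 := Lx)) w + delta (base(K1 := Lx, K2 := L1)) w)
        else delta (base(K1 := Lx, K2 := Lx)))"

definition step :: "nat \<Rightarrow> matching \<Rightarrow> matching \<Rightarrow> matching \<Rightarrow> nat set \<Rightarrow> nat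
    \<Rightarrow> (slab \<Rightarrow> 'r::comm_ring_1) \<Rightarrow> (slab \<Rightarrow> 'r)" where
  "step n a b d P i F =
     (\<lambda>w. \<Sum>u\<in>labs (st_comps n a b d P). F u * saddle n a b d P i u w)"

fun run :: "nat \<Rightarrow> matching \<Rightarrow> matching \<Rightarrow> matching \<Rightarrow> nat set \<Rightarrow> nat list
    \<Rightarrow> (slab \<Rightarrow> 'r::comm_ring_1) \<Rightarrow> (slab \<Rightarrow> 'r)" where
  "run n a b d P [] F = F"
| "run n a b d P (i # is) F = run n a b d (P \<union> {i, b i}) is (step n a b d P i F)"

text \<open>The arcs of b, listed by their lower endpoint (a fixed order of the saddles).\<close>
definition arcs_list :: "nat \<Rightarrow> matching \<Rightarrow> nat list" where
  "arcs_list n b = filter (\<lambda>i. i < b i) [0..<2*n]"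

definition bprod :: "nat \<Rightarrow> hbasis \<Rightarrow> hbasis \<Rightarrow> hbasis \<Rightarrow> 'r::comm_ring_1" where
  "bprod n e1 e2 =
    (case e1 of (a, b, v) \<Rightarrow> case e2 of (c, d, w) \<Rightarrow>
      if b \<noteq> c then (\<lambda>_. 0) else
      (let u0 = (\<lambda>K. if K \<in> st_comps n a b d {}
                       then (if (\<exists>p\<in>K. \<not> fst p) then v (snd ` K) else w (snd ` K))
                       else L1);
           Ff = run n a b d {} (arcs_list n b) (delta u0)
       in (\<lambda>(a', d', v'). if a' = a \<and> d' = d \<and> v' \<in> labs (circles n a d)
             then Ff (\<lambda>K. if K \<in> st_comps n a b d {0..<2*n} then v' (snd ` K) else L1)
             else 0)))"

definition Hmult :: "nat \<Rightarrow> (hbasis \<Rightarrow> 'r::comm_ring_1) \<Rightarrow> (hbasis \<Rightarrow> 'r) \<Rightarrow> (hbasis \<Rightarrow> 'r)" where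
  "Hmult n f g = (\<lambda>e. \<Sum>e1\<in>Hbasis n. \<Sum>e2\<in>Hbasis n. f e1 * g e2 * bprod n e1 e2 e)"

text \<open>Basis of the quotient: basis elements of H_n whose marked circle is labelled 1;
the quotient product is the H_n-product followed by killing basis elements with kappa_0
labelled x (which span I_x).\<close>
definition Hred_basis :: "nat \<Rightarrow> hbasis set" where
  "Hred_basis n = {(a, b, v) \<in> Hbasis n. v (kappa0 n a b) = L1}"

definition Hred_mult :: "nat \<Rightarrow> (hbasis \<Rightarrow> 'r::comm_ring_1) \<Rightarrow> (hbasis \<Rightarrow> 'r) \<Rightarrow> (hbasis \<Rightarrow> 'r)" where
  "Hred_mult n f g = (\<lambda>e. if e \<in> Hred_basis n then Hmult n f g e else 0)"

definition rdeg :: "nat \<Rightarrow> hbasis \<Rightarrow> int" where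
  "rdeg n e = (case e of (a, b, v) \<Rightarrow>
      int (card {\<kappa> \<in> circles n a b. v \<kappa> = L1}) - int (card {\<kappa> \<in> circles n a b. v \<kappa> = Lx})
      - int n - 1)"

definition TA_basis :: "nat \<Rightarrow> (hbasis \<times> lab) set" where
  "TA_basis n = Hred_basis n \<times> UNIV"

definition TA_carrier :: "nat \<Rightarrow> (hbasis \<times> lab \<Rightarrow> 'r::comm_ring_1) set" where
  "TA_carrier n = {F. \<forall>t. t \<notin> TA_basis n \<longrightarrow> F t = 0}"

definition TA_mult :: "nat \<Rightarrow> (hbasis \<times> lab \<Rightarrow> 'r::comm_ring_1) \<Rightarrow> (hbasis \<times> lab \<Rightarrow> 'r)
    \<Rightarrow> (hbasis \<times> lab \<Rightarrow> 'r)" where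
  "TA_mult n F G = (\<lambda>(e, s).
     \<Sum>t1\<in>TA_basis n. \<Sum>t2\<in>TA_basis n.
       F t1 * G t2 * Hred_mult n (delta (fst t1)) (delta (fst t2)) e
         * (if amul (snd t1) (snd t2) = Some s then 1 else 0))"

definition tdeg :: "nat \<Rightarrow> hbasis \<times> lab \<Rightarrow> int" where
  "tdeg n t = rdeg n (fst t) + adeg (snd t)"

definition lam_basis :: "nat \<Rightarrow> hbasis \<times> lab \<Rightarrow> hbasis \<Rightarrow> 'r::comm_ring_1" where
  "lam_basis n t = (case t of ((a, b, v), s) \<Rightarrow>
     (case s of
        Lx \<Rightarrow> delta (a, b, v(kappa0 n a b := Lx))
      | L1 \<Rightarrow> (\<lambda>e'. delta (a, b, v) e'
               + (\<Sum>\<kappa>\<in>{\<kappa> \<in> circles n a b - {kappa0 n a b}. v \<kappa> = Lx}.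
                    delta (a, b, v(kappa0 n a b := Lx, \<kappa> := L1)) e'))))"

definition lam :: "nat \<Rightarrow> (hbasis \<times> lab \<Rightarrow> 'r::comm_ring_1) \<Rightarrow> (hbasis \<Rightarrow> 'r)" where
  "lam n F = (\<lambda>e'. \<Sum>t\<in>TA_basis n. F t * lam_basis n t e')"

definition TA_hom :: "nat \<Rightarrow> int \<Rightarrow> (hbasis \<times> lab \<Rightarrow> 'r::comm_ring_1) set" where
  "TA_hom n k = {F \<in> TA_carrier n. \<forall>t. F t \<noteq> 0 \<longrightarrow> tdeg n t = k}"

definition H_hom :: "nat \<Rightarrow> int \<Rightarrow> (hbasis \<Rightarrow> 'r::comm_ring_1) set" where
  "H_hom n k = {f \<in> H_carrier n. \<forall>e. f e \<noteq> 0 \<longrightarrow> hdeg n e = k}"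

end

theory Submission
  imports Defs
begin

text \<open>
On labelled circles let \<open>D\<close> be the sum over all circles of the operator \<open>x \<mapsto> 1, 1 \<mapsto> 0\<close>, and let \<open>X\<close>
be multiplication by \<open>x\<close> at the marked circle. In characteristic 2 the operator \<open>D\<close> commutes with
Khovanov's merge and split maps, so it is a derivation of the arc algebra; moreover
\<open>X f \<cdot> g = X (f \<cdot> g) = f \<cdot> X g\<close>, \<open>X\<^sup>2 = 0\<close> and \<open>D X + X D = 1\<close>. Since \<open>\<lambda> (f \<otimes> 1) = f + X D f = D X f\<close>
and \<open>\<lambda> (f \<otimes> x) = X f\<close>, multiplicativity follows formally: for instance \<open>X f \<cdot> D X g = X (f \<cdot> g)\<close>
and \<open>X D D X = 0\<close>, hence \<open>D X f \<cdot> D X g = D (X f \<cdot> D X g) = D X (f \<cdot> g)\<close>.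

A saddle on a single circle could fail to split it. This is excluded because arcs of a crossingless
matching join points of opposite parity, which gives a 2-colouring of the points of every
intermediate diagram for which every arc has ends of different colours.
\<close>

section \<open>Components under surgery on an arc diagram\<close>

text \<open>Characteristic 2 is what makes \<open>D\<close> pass through a saddle:
  \<open>D (x \<otimes> x) = 1 \<otimes> x + x \<otimes> 1\<close> merges to \<open>2 x\<close>,
  while \<open>x \<otimes> x\<close> merges to 0; and
  \<open>\<Delta> 1 = 1 \<otimes> x + x \<otimes> 1\<close> is sent by \<open>D\<close> to
  \<open>2 (1 \<otimes> 1)\<close>, while \<open>D 1 = 0\<close>. It also makes
  \<open>D X + X D = 1\<close> true: away from the marked circle \<open>D\<close> and
  \<open>X\<close> commute, so each unmarked circle contributes a doubled term. The form
  \<open>D X f\<close> is preferred to \<open>f + X D f\<close> because the product of the reduced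
  algebra is a truncation: basis elements of \<open>I_x\<close> are dropped. \<open>X\<close>
  annihilates \<open>I_x\<close>, so an expression that sees \<open>f\<close> only through
  \<open>X f\<close> does not notice the truncation, and the whole computation can take place in the
  arc algebra. Bijectivity is a separate matter: sorted by the label of the marked circle,
  \<open>\<lambda>\<close> is triangular with identities on the diagonal.\<close>

lemma even_card_involution:
  assumes "finite A" "\<And>x. x \<in> A \<Longrightarrow> f x \<in> A \<and> f x \<noteq> x \<and> f (f x) = x"
  shows "even (card A)"
  using assms
proof (induction "card A" arbitrary: A rule: less_induct)
  case less
  show ?case
  proof (cases "A = {}")
    case False
    then obtain x where x: "x \<in> A" by blast
    let ?B = "A - {x, f x}"
    have fx: "f x \<in> A" "f x \<noteq> x" using less.prems(2) x by auto
    have sub: "{x, f x} \<subseteq> A" using x fx by auto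
    have c2: "card {x, f x} = 2" using fx by auto
    have cB: "card ?B = card A - 2" using card_Diff_subset[OF _ sub] c2 by simp
    have ge: "2 \<le> card A" using card_mono[OF less.prems(1) sub] c2 by simp
    have "f y \<in> ?B \<and> f y \<noteq> y \<and> f (f y) = y" if "y \<in> ?B" for y
    proof -
      have "f (f y) = y" "f (f x) = x" "f y \<in> A" "f y \<noteq> y" using less.prems(2) that x by auto
      then show ?thesis using that by (metis DiffI DiffD2 insert_iff singletonD)
    qed
    then have "even (card ?B)"
      using less.hyps[of ?B] less.prems(1) cB ge by simp
    then show ?thesis using cB ge by simp
  qed simp
qed

text \<open>Since arcs do not cross, the points strictly between the two ends of an arc are matched
  among themselves, so their number is even.\<close>

lemma Cn_parity:
  assumes m: "m \<in> Cn n" and i: "i < 2 * n"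
  shows "even (m i) \<longleftrightarrow> odd i"
proof -
  have mat: "m j < 2*n" "m j \<noteq> j" "m (m j) = j" if "j < 2*n" for j
    using m that by (auto simp: Cn_def is_matching_def)
  have nc: "i < m j \<and> m j < m i" if "i < j" "j < m i" "m i < 2*n" for i j
    using m that by (auto simp: Cn_def noncrossing_def)
  have *: "even (m j) \<longleftrightarrow> odd j" if j: "j < m j" "j < 2*n" for j
  proof -
    have "even (card {j<..<m j})"
    proof (rule even_card_involution[where f = m])
      fix x assume "x \<in> {j<..<m j}"
      then show "m x \<in> {j<..<m j} \<and> m x \<noteq> x \<and> m (m x) = x"
        using nc[of j x] mat(1)[OF j(2)] mat[of x] by auto
    qed simp
    then have "even (m j - Suc j)" by simp
    then show ?thesis using j by presburger
  qed
  show ?thesis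
  proof (cases "i < m i")
    case False
    then have "m i < m (m i)" using mat[OF i] by auto
    then show ?thesis using *[of "m i"] mat[OF i] by auto
  qed (use * i in auto)
qed

section \<open>Cutting two arcs of a diagram and reconnecting their ends\<close>

definition arc_rel :: "'v set \<Rightarrow> ('v \<Rightarrow> 'v) \<Rightarrow> ('v \<times> 'v) set" where
  "arc_rel V f = {(x, f x) | x. x \<in> V}"

lemma funpow_returns:
  assumes "finite V" "inj_on f V" "f ` V \<subseteq> V" "p \<in> V"
  shows "\<exists>N>0. (f ^^ N) p = p"
proof -
  have inV: "(f ^^ k) p \<in> V" for k
    using assms(3,4) by (induction k) auto
  then have "finite (range (\<lambda>k. (f ^^ k) p))"
    using assms(1) by (auto intro: finite_subset[of _ V])
  then have "\<not> inj (\<lambda>k. (f ^^ k) p)"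
    using finite_imageD infinite_UNIV_nat by metis
  then obtain i j where "i \<noteq> j" "(f ^^ i) p = (f ^^ j) p"
    by (auto simp: inj_def)
  then obtain i j where ij: "i < j" "(f ^^ i) p = (f ^^ j) p"
    by (cases i j rule: linorder_cases) auto
  have cancel: "(f ^^ i) p = (f ^^ (i + m)) p \<Longrightarrow> p = (f ^^ m) p" for i m
  proof (induction i)
    case (Suc i)
    then have "(f ^^ i) p = (f ^^ (i + m)) p"
      using assms(2) inV by (auto dest: inj_onD)
    then show ?case using Suc.IH by blast
  qed simp
  show ?thesis using cancel[of i "j - i"] ij by (intro exI[of _ "j - i"]) auto
qed

text \<open>The inner arcs \<open>p\<close>--\<open>q\<close> and \<open>r\<close>--\<open>t\<close>
  are replaced by \<open>p\<close>--\<open>r\<close> and \<open>q\<close>--\<open>t\<close>. As arcs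
  join different colours, \<open>q\<close> and \<open>r\<close> both have the colour opposite to
  that of \<open>p\<close> and \<open>t\<close>, so the new arcs respect the colouring too.\<close>

locale surgery =
  fixes V :: "'v set" and out inn inn' :: "'v \<Rightarrow> 'v" and col :: "'v \<Rightarrow> bool" and p q r t :: 'v
  assumes fin: "finite V"
    and out: "\<And>x. x \<in> V \<Longrightarrow> out x \<in> V \<and> out (out x) = x \<and> col (out x) \<noteq> col x"
    and inn: "\<And>x. x \<in> V \<Longrightarrow> inn x \<in> V \<and> inn (inn x) = x \<and> col (inn x) \<noteq> col x"
    and pt: "p \<in> V" "t \<in> V" "p \<noteq> t" "col p = col t" "q = inn p" "r = inn t"
    and inn'_pts: "inn' p = r" "inn' r = p" "inn' q = t" "inn' t = q"
    and inn'_other: "\<And>x. x \<in> V \<Longrightarrow> x \<notin> {p, q, r, t} \<Longrightarrow> inn' x = inn x"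
begin

definition "E = arc_rel V out \<union> arc_rel V inn"
definition "E' = arc_rel V out \<union> arc_rel V inn'"
definition "E0 = arc_rel V out \<union> arc_rel (V - {p, q, r, t}) inn"

lemma inn_pts: "inn p = q" "inn q = p" "inn r = t" "inn t = r" "q \<in> V" "r \<in> V"
  using pt inn by auto

lemma E_eq: "E = E0 \<union> {(p, q), (q, p), (r, t), (t, r)}"
  using inn_pts pt(1,2) by (auto simp: E_def E0_def arc_rel_def)

lemma E'_eq: "E' = E0 \<union> {(p, r), (r, p), (q, t), (t, q)}"
proof -
  have "arc_rel (V - {p, q, r, t}) inn = arc_rel (V - {p, q, r, t}) inn'"
    using inn'_other by (auto simp: arc_rel_def)
  moreover have "arc_rel V inn' = arc_rel (V - {p, q, r, t}) inn' \<union> {(p, r), (r, p), (q, t), (t, q)}"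
    using inn'_pts inn_pts pt(1,2) by (auto simp: arc_rel_def)
  ultimately show ?thesis by (auto simp: E'_def E0_def)
qed

lemma sym_E0: "sym E0"
proof -
  have "inn x \<in> V - {p, q, r, t}" if "x \<in> V - {p, q, r, t}" for x
    using inn[of x] that inn_pts by auto
  then show ?thesis
    using out inn by (auto simp: sym_def E0_def arc_rel_def)
qed

lemma sym_E: "sym E" and sym_E': "sym E'"
  using sym_E0 by (auto simp: sym_def E_eq E'_eq)


text \<open>Follow the outer and inner arcs alternately from \<open>p\<close> until the first removed arc is met:
this path contains exactly one further endpoint of a removed arc, and by the colouring that
endpoint is \<open>q\<close> or \<open>r\<close>.\<close>

lemma path_after_cut:
  obtains C where "p \<in> C" "t \<notin> C" "q \<in> C \<longleftrightarrow> r \<notin> C" "E0 `` C \<subseteq> C" "C \<subseteq> E0\<^sup>* `` {p}"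
proof -
  \<comment> \<open>Two arcs in a row restore the colour: the \<open>f\<close>-orbit of
    \<open>p\<close> has the colour of \<open>p\<close>, and its image under \<open>out\<close> has
    the other one.\<close>
  define f where "f = inn \<circ> out"
  have fV: "f ` V \<subseteq> V" using out inn by (auto simp: f_def)
  have "inj_on f V"
    by (rule inj_on_inverseI[where g = "out \<circ> inn"]) (use out inn in \<open>auto simp: f_def\<close>)
  then obtain N where "N > 0" "(f ^^ N) p = p"
    using funpow_returns[OF fin _ fV pt(1)] by blast
  then obtain M where M: "f ((f ^^ M) p) = p" by (cases N) auto
  have inV: "(f ^^ k) p \<in> V" for k using fV pt(1) by (induction k) auto
  have colf: "col ((f ^^ k) p) = col p" for k
    using out inn inV by (induction k) (auto simp: f_def)
  \<comment> \<open>The orbit closes up at \<open>p\<close>, and its last step arrives there through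
    the removed arc from \<open>q\<close>. Hence some outer arc that starts on the orbit ends at a
    cut point.\<close>
  have "out ((f ^^ M) p) = q"
    using M inn[of "out ((f ^^ M) p)"] out[OF inV[of M]] pt(5) by (auto simp: f_def)
  then have ex: "\<exists>k. out ((f ^^ k) p) \<in> {q, r}" by blast
  define k where "k = (LEAST k. out ((f ^^ k) p) \<in> {q, r})"
  have k: "out ((f ^^ k) p) \<in> {q, r}" unfolding k_def using LeastI_ex[OF ex] .
  have less: "out ((f ^^ j) p) \<notin> {q, r}" if "j < k" for j
    using not_less_Least that unfolding k_def by blast
  define A where "A = (\<lambda>j. (f ^^ j) p) ` {..k}"
  define C where "C = A \<union> out ` A"
  have colA: "col x = col p" "x \<in> V" if "x \<in> A" for x
    using that colf inV by (auto simp: A_def)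
  have colB: "col x \<noteq> col p" if "x \<in> out ` A" for x
    using that colA out by auto
  have colqr: "col q \<noteq> col p" "col r \<noteq> col p" using pt inn by auto
  have qr: "q \<noteq> r" using pt inn by metis
  have pA: "p \<in> A" by (auto simp: A_def intro: image_eqI[of _ _ 0])
  \<comment> \<open>Arriving at \<open>t\<close> would mean crossing the removed arc from
    \<open>r\<close>, although no cut point is met before index \<open>k\<close>.\<close>
  have tA: "t \<notin> A"
  proof
    assume "t \<in> A"
    then obtain j where j: "j \<le> k" "t = (f ^^ j) p" by (auto simp: A_def)
    with pt(3) obtain i where "j = Suc i" by (cases j) auto
    then have "t = inn (out ((f ^^ i) p))" "i < k" using j by (auto simp: f_def)
    then show False using less[of i] pt(6) inn[of "out ((f ^^ i) p)"] out[OF inV[of i]] by auto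
  qed
  have outk: "x \<in> out ` A \<and> x \<in> {q, r} \<longleftrightarrow> x = out ((f ^^ k) p)" for x
    using k less by (auto simp: A_def le_less) blast+
  have mem: "x \<in> C \<longleftrightarrow> x \<in> out ` A" if "x \<in> {q, r}" for x
    using that colqr colA by (auto simp: C_def)
  have "p \<in> C" using pA by (simp add: C_def)
  moreover have "t \<notin> C" using tA colB pt(4) by (auto simp: C_def)
  moreover have "q \<in> C \<longleftrightarrow> r \<notin> C" using outk[of q] outk[of r] mem[of q] mem[of r] qr k
    by (metis insert_iff singletonD)
  moreover have "E0 `` C \<subseteq> C"
  proof -
    have "out x \<in> C" if "x \<in> C" for x using that colA out by (auto simp: C_def)
    moreover have "inn x \<in> C" if x: "x \<in> C" "x \<notin> {p, q, r, t}" for x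
      using x(1) unfolding C_def
    proof
      assume "x \<in> A"
      then obtain j where j: "j \<le> k" "x = (f ^^ j) p" by (auto simp: A_def)
      with x(2) obtain i where "j = Suc i" by (cases j) auto
      then have "inn x = out ((f ^^ i) p)" "i \<le> k"
        using j inn out[OF inV[of i]] by (auto simp: f_def)
      then show "inn x \<in> A \<union> out ` A" by (auto simp: A_def)
    next
      assume "x \<in> out ` A"
      then obtain j where j: "j \<le> k" "x = out ((f ^^ j) p)" by (auto simp: A_def)
      then have "Suc j \<le> k" using x(2) k by (cases "j = k") auto
      moreover have "inn x = (f ^^ Suc j) p" using j by (simp add: f_def)
      ultimately show "inn x \<in> A \<union> out ` A" unfolding A_def by blast
    qed
    ultimately show ?thesis by (auto simp: E0_def arc_rel_def)
  qed
  moreover have "C \<subseteq> E0\<^sup>* `` {p}"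
  proof -
    have step_out: "(x, out x) \<in> E0" if "x \<in> V" for x
      using that by (auto simp: E0_def arc_rel_def)
    have "j \<le> k \<Longrightarrow> (p, (f ^^ j) p) \<in> E0\<^sup>*" for j
    proof (induction j)
      case (Suc j)
      let ?y = "out ((f ^^ j) p)"
      have "?y \<notin> {q, r}" using less Suc.prems by auto
      moreover have "?y \<notin> {p, t}" using out[OF inV[of j]] colf pt(4) by auto
      ultimately have "(?y, inn ?y) \<in> E0"
        using out[OF inV[of j]] by (auto simp: E0_def arc_rel_def)
      moreover have "inn ?y = (f ^^ Suc j) p" by (simp add: f_def)
      ultimately show ?case
        using Suc step_out[OF inV[of j]] by (metis Suc_leD rtrancl.rtrancl_into_rtrancl)
    qed simp
    then have "A \<subseteq> E0\<^sup>* `` {p}" by (auto simp: A_def)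
    then show ?thesis using step_out colA(2) by (force simp: C_def intro: rtrancl_into_rtrancl)
  qed
  ultimately show ?thesis using that by blast
qed

text \<open>The path \<open>C\<close> from \<open>p\<close> ends at exactly one of \<open>q\<close>
  and \<open>r\<close>. If at \<open>q\<close>, it is closed under the old arcs and misses
  \<open>r\<close>, and it joins \<open>p\<close> to \<open>q\<close> after the surgery. If at
  \<open>r\<close>, it joins \<open>p\<close> to \<open>r\<close> before the surgery, and it is
  closed under the new arcs and misses \<open>q\<close>. A path ending at \<open>t\<close> would be
  the case of one circle that stays one circle.\<close>

lemma reconnect_iff: "(p, r) \<in> E\<^sup>* \<longleftrightarrow> (p, q) \<notin> E'\<^sup>*"
proof -
  obtain C where C: "p \<in> C" "t \<notin> C" "q \<in> C \<longleftrightarrow> r \<notin> C" "E0 `` C \<subseteq> C" "C \<subseteq> E0\<^sup>* `` {p}"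
    by (rule path_after_cut)
  show ?thesis
  proof (cases "q \<in> C")
    case True
    then have "E `` C \<subseteq> C" using C by (auto simp: E_eq)
    then have "E\<^sup>* `` C = C" by (rule Image_closed_trancl)
    moreover have "(p, q) \<in> E'\<^sup>*" using True C(5) rtrancl_mono[of E0 E'] by (auto simp: E'_eq)
    ultimately show ?thesis using C True by auto
  next
    case False
    then have "E' `` C \<subseteq> C" using C by (auto simp: E'_eq)
    then have "E'\<^sup>* `` C = C" by (rule Image_closed_trancl)
    moreover have "(p, r) \<in> E\<^sup>*" using False C rtrancl_mono[of E0 E] by (auto simp: E_eq)
    ultimately show ?thesis using C False by auto
  qed
qed

section \<open>Circles before and after the surgery\<close>

abbreviation "cmp x \<equiv> E\<^sup>* `` {x}"
abbreviation "cmp' x \<equiv> E'\<^sup>* `` {x}"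

lemma cmp_eq_iff: "cmp x = cmp y \<longleftrightarrow> (x, y) \<in> E\<^sup>*"
  using sym_rtrancl[OF sym_E] by (auto dest: symD intro: rtrancl_trans)

lemma cmp'_eq_iff: "cmp' x = cmp' y \<longleftrightarrow> (x, y) \<in> E'\<^sup>*"
  using sym_rtrancl[OF sym_E'] by (auto dest: symD intro: rtrancl_trans)

lemma cmp_q: "cmp q = cmp p" and cmp_t: "cmp t = cmp r"
  unfolding cmp_eq_iff by (auto simp: E_eq)

lemma cmp'_r: "cmp' r = cmp' p" and cmp'_t: "cmp' t = cmp' q"
  unfolding cmp'_eq_iff by (auto simp: E'_eq)

text \<open>Each side contains all four cut points, so it is closed under the old and the new arcs
  alike; each side is generated by two of these points and hence lies in the other.\<close>

lemma union_eq: "cmp p \<union> cmp r = cmp' p \<union> cmp' q"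
proof
  let ?U = "cmp p \<union> cmp r" and ?U' = "cmp' p \<union> cmp' q"
  have "E\<^sup>* `` ?U' = ?U'"
  proof (rule Image_closed_trancl)
    have "E' `` ?U' \<subseteq> ?U'" by (auto intro: rtrancl_into_rtrancl)
    moreover have "{p, q, r, t} \<subseteq> ?U'" using cmp'_r cmp'_t by auto
    ultimately show "E `` ?U' \<subseteq> ?U'" by (auto simp: E_eq E'_eq)
  qed
  moreover have "p \<in> ?U'" "r \<in> ?U'" using cmp'_r by auto
  ultimately show "?U \<subseteq> ?U'" by blast
  have "E'\<^sup>* `` ?U = ?U"
  proof (rule Image_closed_trancl)
    have "E `` ?U \<subseteq> ?U" by (auto intro: rtrancl_into_rtrancl)
    moreover have "{p, q, r, t} \<subseteq> ?U" using cmp_q cmp_t by auto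
    ultimately show "E' `` ?U \<subseteq> ?U" by (auto simp: E_eq E'_eq)
  qed
  moreover have "p \<in> ?U" "q \<in> ?U" using cmp_q by auto
  ultimately show "?U' \<subseteq> ?U" by blast
qed

lemma cmp_other:
  assumes "x \<notin> cmp p \<union> cmp r"
  shows "cmp x = cmp' x"
proof -
  let ?U = "cmp p \<union> cmp r"
  have disj: "y \<notin> {p, q, r, t}" if "y \<in> cmp x" for y
    using that assms cmp_eq_iff cmp_q cmp_t by blast
  have disj': "y \<notin> {p, q, r, t}" if "y \<in> cmp' x" for y
    using that assms union_eq cmp'_eq_iff cmp'_r cmp'_t by blast
  have "E'\<^sup>* `` cmp x = cmp x"
    by (rule Image_closed_trancl) (use disj in \<open>auto simp: E_eq E'_eq intro: rtrancl_into_rtrancl\<close>)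
  moreover have "E\<^sup>* `` cmp' x = cmp' x"
    by (rule Image_closed_trancl) (use disj' in \<open>auto simp: E_eq E'_eq intro: rtrancl_into_rtrancl\<close>)
  ultimately show ?thesis by blast
qed

definition "others = cmp ` (V - (cmp p \<union> cmp r))"

lemma cmps_eq: "cmp ` V = others \<union> {cmp p, cmp r}"
proof -
  have "cmp x \<in> {cmp p, cmp r}" if "x \<in> cmp p \<union> cmp r" for x
    using that cmp_eq_iff by blast
  then show ?thesis using pt(1) inn_pts(6) unfolding others_def by blast
qed

lemma cmps'_eq: "cmp' ` V = others \<union> {cmp' p, cmp' q}"
proof -
  have "cmp' x \<in> {cmp' p, cmp' q}" if "x \<in> cmp p \<union> cmp r" for x
    using that cmp'_eq_iff unfolding union_eq by blast
  moreover have "others = cmp' ` (V - (cmp p \<union> cmp r))"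
    unfolding others_def using cmp_other by (intro image_cong) auto
  ultimately show ?thesis using pt(1) inn_pts(5) by blast
qed

lemma cmps_notin_others: "cmp p \<notin> others" "cmp r \<notin> others"
  unfolding others_def by auto

lemma cmps'_notin_others: "cmp' p \<notin> others" "cmp' q \<notin> others"
  using union_eq unfolding others_def by blast+

text \<open>The new circle is the union of two distinct old ones. That it differs from both lets a
  single labelling be updated at old and new circles independently, as \<open>merge_op\<close>
  does.\<close>

lemma merge_comps:
  assumes "cmp p \<noteq> cmp r"
  shows "cmp' q = cmp' p" "cmp' p \<noteq> cmp p" "cmp' p \<noteq> cmp r"
proof -
  show eq: "cmp' q = cmp' p"
    using assms reconnect_iff unfolding cmp_eq_iff by (metis cmp'_eq_iff)
  then show "cmp' p \<noteq> cmp p" "cmp' p \<noteq> cmp r"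
    using union_eq assms cmp_eq_iff by blast+
qed

lemma split_comps:
  assumes "cmp p = cmp r"
  shows "cmp' p \<noteq> cmp' q" "cmp' p \<noteq> cmp p" "cmp' q \<noteq> cmp p"
proof -
  show neq: "cmp' p \<noteq> cmp' q"
    using assms reconnect_iff unfolding cmp_eq_iff cmp'_eq_iff by blast
  then show "cmp' p \<noteq> cmp p" "cmp' q \<noteq> cmp p"
    using union_eq assms cmp'_eq_iff by blast+
qed

end

section \<open>Merge and split operators on labellings\<close>

lemma UNIV_lab: "UNIV = {L1, Lx}"
  using lab.exhaust by blast

instance lab :: finite
  by standard (simp add: UNIV_lab)

lemma finite_labs:
  assumes "finite S"
  shows "finite (labs S)"
proof -
  have "labs S \<subseteq> {f. \<forall>x. (x \<in> S \<longrightarrow> f x \<in> UNIV) \<and> (x \<notin> S \<longrightarrow> f x = L1)}"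
    by (auto simp: labs_def)
  then show ?thesis
    using finite_set_of_finite_funs[OF assms, of "UNIV :: lab set" L1] finite_subset by auto
qed

lemma not_L1 [simp]: "s \<noteq> L1 \<longleftrightarrow> s = Lx" and not_Lx [simp]: "s \<noteq> Lx \<longleftrightarrow> s = L1"
  by (cases s; simp)+

text \<open>A function on labellings is the coefficient vector of a linear combination, so the operators
below read backwards: \<open>unx k\<close> is \<open>x \<mapsto> 1, 1 \<mapsto> 0\<close> at \<open>k\<close>, and \<open>mulx k\<close> is multiplication by \<open>x\<close> at \<open>k\<close>.\<close>

definition unx :: "'k \<Rightarrow> (('k \<Rightarrow> lab) \<Rightarrow> 'r::comm_ring_1) \<Rightarrow> ('k \<Rightarrow> lab) \<Rightarrow> 'r" where
  "unx k F u = (if u k = L1 then F (u(k := Lx)) else 0)"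

definition mulx :: "'k \<Rightarrow> (('k \<Rightarrow> lab) \<Rightarrow> 'r::comm_ring_1) \<Rightarrow> ('k \<Rightarrow> lab) \<Rightarrow> 'r" where
  "mulx k F u = (if u k = Lx then F (u(k := L1)) else 0)"

definition ddx :: "'k set \<Rightarrow> (('k \<Rightarrow> lab) \<Rightarrow> 'r::comm_ring_1) \<Rightarrow> ('k \<Rightarrow> lab) \<Rightarrow> 'r" where
  "ddx S F u = (\<Sum>k\<in>S. unx k F u)"

lemma upd_labs: "k \<in> S \<Longrightarrow> u(k := s) \<in> labs S \<longleftrightarrow> u \<in> labs S"
  by (auto simp: labs_def)

text \<open>Coefficient vectors are truncated to canonical labellings. Relabelling a circle of
  \<open>S\<close> does not change membership in \<open>labs S\<close>, so the truncation can be
  pulled out of the operators.\<close>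

lemma ddx_restrict:
  "ddx S (\<lambda>w. if w \<in> labs S then G w else 0) = (\<lambda>w. if w \<in> labs S then ddx S G w else 0)"
  by (auto simp: ddx_def unx_def upd_labs fun_eq_iff intro!: sum.cong sum.neutral)

lemma mulx_restrict:
  "k \<in> S \<Longrightarrow> mulx k (\<lambda>w. if w \<in> labs S then G w else 0) = (\<lambda>w. if w \<in> labs S then mulx k G w else 0)"
  by (auto simp: mulx_def upd_labs fun_eq_iff)

text \<open>The transpose of multiplication on \<open>A\<close>: label 1 at the merged circle arises
  from \<open>1 \<otimes> 1\<close> only, label \<open>x\<close> from \<open>1 \<otimes> x\<close>
  and \<open>x \<otimes> 1\<close>. The circle \<open>K\<close> is absent from the source diagram
  and is reset to the default label.\<close>

definition merge_op :: "'k \<Rightarrow> 'k \<Rightarrow> 'k \<Rightarrow> (('k \<Rightarrow> lab) \<Rightarrow> 'r::comm_ring_1) \<Rightarrow> ('k \<Rightarrow> lab) \<Rightarrow> 'r" where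
  "merge_op L R K F w =
    (if w K = L1 then F (w(K := L1, L := L1, R := L1))
     else F (w(K := L1, L := L1, R := Lx)) + F (w(K := L1, L := Lx, R := L1)))"

text \<open>The transpose of \<open>\<Delta>\<close>: \<open>1 \<otimes> 1\<close> occurs in no
  value, the two mixed labels come from 1, and \<open>x \<otimes> x\<close> comes from
  \<open>x\<close>.\<close>

definition split_op :: "'k \<Rightarrow> 'k \<Rightarrow> 'k \<Rightarrow> (('k \<Rightarrow> lab) \<Rightarrow> 'r::comm_ring_1) \<Rightarrow> ('k \<Rightarrow> lab) \<Rightarrow> 'r" where
  "split_op L K1 K2 F w =
    (if w K1 = L1 \<and> w K2 = L1 then 0
     else F (w(K1 := L1, K2 := L1, L := (if w K1 = Lx \<and> w K2 = Lx then Lx else L1))))"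

lemma merge_unx:
  assumes "k \<notin> {L, R, K}"
  shows "unx k (merge_op L R K F) w = merge_op L R K (unx k F) w"
proof -
  have "w(k := Lx, K := x, L := y, R := z) = w(K := x, L := y, R := z, k := Lx)" for x y z
    using assms by auto
  then show ?thesis using assms by (auto simp: unx_def merge_op_def)
qed

lemma merge_mulx_other:
  assumes "k \<notin> {L, R, K}"
  shows "mulx k (merge_op L R K F) w = merge_op L R K (mulx k F) w"
proof -
  have "w(k := L1, K := x, L := y, R := z) = w(K := x, L := y, R := z, k := L1)" for x y z
    using assms by auto
  then show ?thesis using assms by (auto simp: mulx_def merge_op_def)
qed

lemma split_unx:
  assumes "k \<notin> {L, K1, K2}"
  shows "unx k (split_op L K1 K2 F) w = split_op L K1 K2 (unx k F) w"
proof -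
  have "w(k := Lx, K1 := x, K2 := y, L := z) = w(K1 := x, K2 := y, L := z, k := Lx)" for x y z
    using assms by auto
  then show ?thesis using assms by (auto simp add: unx_def split_op_def)
qed

lemma split_mulx_other:
  assumes "k \<notin> {L, K1, K2}"
  shows "mulx k (split_op L K1 K2 F) w = split_op L K1 K2 (mulx k F) w"
proof -
  have "w(k := L1, K1 := x, K2 := y, L := z) = w(K1 := x, K2 := y, L := z, k := L1)" for x y z
    using assms by auto
  then show ?thesis using assms by (auto simp add: mulx_def split_op_def)
qed

text \<open>Multiplication on \<open>A\<close> is bilinear over \<open>A\<close>, so a factor
  \<open>x\<close> on the merged circle may be placed on either of the old circles.\<close>

lemma merge_mulx:
  assumes "L \<noteq> R" "K \<noteq> L" "K \<noteq> R"
  shows "mulx K (merge_op L R K F) w = merge_op L R K (mulx L F) w"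
    and "mulx K (merge_op L R K F) w = merge_op L R K (mulx R F) w"
proof -
  have "w(K := L1, L := x, R := y, L := z) = w(K := L1, L := z, R := y)" for x y z
    using assms by auto
  then show "mulx K (merge_op L R K F) w = merge_op L R K (mulx L F) w"
    "mulx K (merge_op L R K F) w = merge_op L R K (mulx R F) w"
    using assms by (auto simp: mulx_def merge_op_def)
qed

text \<open>\<open>\<Delta>\<close> is a map of \<open>A\<close>-bimodules, so a factor
  \<open>x\<close> on the old circle may be placed on either of the new ones.\<close>

lemma split_mulx:
  assumes "K1 \<noteq> K2" "K1 \<noteq> L" "K2 \<noteq> L"
  shows "mulx K1 (split_op L K1 K2 F) w = split_op L K1 K2 (mulx L F) w"
    and "mulx K2 (split_op L K1 K2 F) w = split_op L K1 K2 (mulx L F) w"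
proof -
  have "w(K2 := L1, K1 := x, K2 := y, L := z) = w(K1 := x, K2 := y, L := z)" for x y z
    using assms by auto
  then show "mulx K1 (split_op L K1 K2 F) w = split_op L K1 K2 (mulx L F) w"
    "mulx K2 (split_op L K1 K2 F) w = split_op L K1 K2 (mulx L F) w"
    using assms by (auto simp: mulx_def split_op_def)
qed

text \<open>The last assumption has the shape of the tracking clause of \<open>saddle_cases\<close>:
  \<open>k\<close> and \<open>k'\<close> stand for the circles through one fixed point before and
  after the merge.\<close>

lemma mulx_merge_op:
  assumes "L \<notin> C" "R \<notin> C" "K \<notin> C" "L \<noteq> R" "K \<noteq> L" "K \<noteq> R"
    and "k \<in> C \<and> k' = k \<or> k \<in> {L, R} \<and> k' = K"
  shows "mulx k' (merge_op L R K F) w = merge_op L R K (mulx k F) w"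
proof -
  have "k \<notin> {L, R, K}" if "k \<in> C" using that assms by auto
  then show ?thesis
    using assms(7) merge_mulx[OF assms(4-6), of F w] merge_mulx_other[of k L R K F w] by auto
qed

lemma mulx_split_op:
  assumes "L \<notin> C" "K1 \<notin> C" "K2 \<notin> C" "K1 \<noteq> K2" "K1 \<noteq> L" "K2 \<noteq> L"
    and "k \<in> C \<and> k' = k \<or> k = L \<and> k' \<in> {K1, K2}"
  shows "mulx k' (split_op L K1 K2 F) w = split_op L K1 K2 (mulx k F) w"
proof -
  have "k \<notin> {L, K1, K2}" if "k \<in> C" using that assms by auto
  then show ?thesis
    using assms(7) split_mulx[OF assms(4-6), of F w] split_mulx_other[of k L K1 K2 F w] by auto
qed

lemma merge_sum_op: "merge_op L R K (\<lambda>u. \<Sum>k\<in>S. G k u) w = (\<Sum>k\<in>S. merge_op L R K (G k) w)"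
  by (simp add: merge_op_def sum.distrib)

lemma split_sum_op: "split_op L K1 K2 (\<lambda>u. \<Sum>k\<in>S. G k u) w = (\<Sum>k\<in>S. split_op L K1 K2 (G k) w)"
  by (simp add: split_op_def)

text \<open>Away from the saddle the operators act on different tensor factors. At the saddle,
  \<open>1 \<otimes> x\<close> and \<open>x \<otimes> 1\<close> go to 1 either way,
  \<open>1 \<otimes> 1\<close> goes to 0, and \<open>x \<otimes> x\<close> compares
  \<open>2 x\<close> with 0.\<close>

lemma merge_ddx:
  fixes F :: "('k \<Rightarrow> lab) \<Rightarrow> 'r::comm_ring_1"
  assumes two: "\<And>x::'r. x + x = 0"
    and "finite C" "L \<notin> C" "R \<notin> C" "K \<notin> C" "L \<noteq> R" "K \<noteq> L" "K \<noteq> R"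
  shows "ddx (C \<union> {K}) (merge_op L R K F) w = merge_op L R K (ddx (C \<union> {L, R}) F) w"
proof -
  have tw: "w(K := L1, L := x, R := y, L := z) = w(K := L1, L := z, R := y)" for x y z
    using assms by auto
  have "unx K (merge_op L R K F) w = merge_op L R K (unx L F) w + merge_op L R K (unx R F) w"
    using assms(6-8) by (auto simp: unx_def merge_op_def tw two add.commute)
  moreover have "(\<Sum>k\<in>C. unx k (merge_op L R K F) w) = (\<Sum>k\<in>C. merge_op L R K (unx k F) w)"
    using assms by (intro sum.cong refl merge_unx) auto
  ultimately show ?thesis
    using assms unfolding ddx_def merge_sum_op by (simp add: add.assoc)
qed

text \<open>At the saddle \<open>x\<close> goes to \<open>\<Delta> 1 = D (x \<otimes> x)\<close>
  either way, and 1 compares 0 with \<open>2 (1 \<otimes> 1)\<close>.\<close>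

lemma split_ddx:
  fixes F :: "('k \<Rightarrow> lab) \<Rightarrow> 'r::comm_ring_1"
  assumes two: "\<And>x::'r. x + x = 0"
    and "finite C" "L \<notin> C" "K1 \<notin> C" "K2 \<notin> C" "K1 \<noteq> K2" "K1 \<noteq> L" "K2 \<noteq> L"
  shows "ddx (C \<union> {K1, K2}) (split_op L K1 K2 F) w = split_op L K1 K2 (ddx (C \<union> {L}) F) w"
proof -
  have tw: "w(K2 := x', K1 := x, K2 := y, L := z) = w(K1 := x, K2 := y, L := z)" for x' x y z
    using assms by auto
  have "unx K1 (split_op L K1 K2 F) w + unx K2 (split_op L K1 K2 F) w = split_op L K1 K2 (unx L F) w"
    using assms(6-8) by (auto simp: unx_def split_op_def tw two)
  moreover have "(\<Sum>k\<in>C. unx k (split_op L K1 K2 F) w) = (\<Sum>k\<in>C. split_op L K1 K2 (unx k F) w)"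
    using assms by (intro sum.cong refl split_unx) auto
  ultimately show ?thesis
    using assms unfolding ddx_def split_sum_op by (simp add: add.assoc[symmetric] add.commute)
qed

text \<open>The left side is \<open>step\<close> at a merge, a sum over source labellings; the right
  side collects the coefficient of \<open>w\<close> from the few labellings that can produce
  it.\<close>

lemma merge_op_eq_sum:
  fixes F :: "('k \<Rightarrow> lab) \<Rightarrow> 'r::comm_ring_1"
  assumes C: "finite C" "L \<notin> C" "R \<notin> C" "K \<notin> C" "L \<noteq> R" "K \<noteq> L" "K \<noteq> R"
    and S: "S = C \<union> {L, R}" "S' = C \<union> {K}"
  shows "(\<Sum>u\<in>labs S. F u * (case amul (u L) (u R) of None \<Rightarrow> (\<lambda>_. 0)
            | Some s \<Rightarrow> delta ((\<lambda>k. if k \<in> S' then u k else L1)(K := s))) w)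
       = (if w \<in> labs S' then merge_op L R K F w else 0)" (is "sum ?h _ = _")
proof (cases "w \<in> labs S'")
  case False
  have "?h u = 0" if "u \<in> labs S" for u
  proof (cases "amul (u L) (u R)")
    case (Some s)
    have "(\<lambda>k. if k \<in> S' then u k else L1)(K := s) \<in> labs S'" using S by (auto simp: labs_def)
    then show ?thesis using False Some by (auto simp: delta_def)
  qed simp
  then show ?thesis using False by simp
next
  case True
  \<comment> \<open>The only candidates for a source of \<open>w\<close>: they agree with
    \<open>w\<close> off the saddle, have free labels on the two old circles and the default label
    on \<open>K\<close>.\<close>
  define g where "g st = w(K := L1, L := fst st, R := snd st)" for st
  have gS: "range g \<subseteq> labs S" using True S C by (auto simp: g_def labs_def)
  have inj: "inj g"
    by (rule inj_on_inverseI[where g = "\<lambda>u. (u L, u R)"]) (use C in \<open>auto simp: g_def\<close>)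
  have zero: "?h u = 0" if u: "u \<in> labs S - range g" for u
  proof (rule ccontr)
    assume nz: "?h u \<noteq> 0"
    then obtain s where "amul (u L) (u R) = Some s" by (cases "amul (u L) (u R)") auto
    with nz have w: "w = (\<lambda>k. if k \<in> S' then u k else L1)(K := s)"
      by (auto simp: delta_def split: if_splits)
    have "u = g (u L, u R)"
    proof
      fix k
      show "u k = g (u L, u R) k"
        using u S C by (auto simp: g_def w labs_def)
    qed
    then show False using u by (metis DiffD2 rangeI)
  qed
  have val: "(\<lambda>k. if k \<in> S' then g (s, t) k else L1)(K := x) = w(K := x)" for s t x
    using True S C by (auto simp: g_def labs_def)
  have d: "delta (w(K := x)) w = (if w K = x then 1 else 0 :: 'r)" for x
    by (auto simp: delta_def fun_upd_idem_iff) (metis fun_upd_same)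
  have gLR: "g (s, t) L = s" "g (s, t) R = t" for s t using C by (auto simp: g_def)
  have "sum ?h (labs S) = sum ?h (range g)"
    using zero gS C S by (intro sum.mono_neutral_right finite_labs) auto
  also have "\<dots> = (\<Sum>st\<in>UNIV. ?h (g st))" using inj by (simp add: sum.reindex)
  also have "\<dots> = ?h (g (L1, L1)) + ?h (g (L1, Lx)) + ?h (g (Lx, L1)) + ?h (g (Lx, Lx))"
    unfolding UNIV_Times_UNIV[symmetric] UNIV_lab by (simp add: add.assoc)
  also have "\<dots> = merge_op L R K F w"
    unfolding gLR using d val by (cases "w K") (auto simp: merge_op_def g_def)
  finally show ?thesis using True by simp
qed

lemma split_op_eq_sum:
  fixes F :: "('k \<Rightarrow> lab) \<Rightarrow> 'r::comm_ring_1"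
  assumes C: "finite C" "L \<notin> C" "K1 \<notin> C" "K2 \<notin> C" "K1 \<noteq> K2" "K1 \<noteq> L" "K2 \<noteq> L"
    and S: "S = C \<union> {L}" "S' = C \<union> {K1, K2}"
  defines "base \<equiv> \<lambda>u k. if k \<in> S' then u k else L1"
  shows "(\<Sum>u\<in>labs S. F u * (if u L = L1 then
            (\<lambda>w. delta ((base u)(K1 := L1, K2 := Lx)) w + delta ((base u)(K1 := Lx, K2 := L1)) w)
            else delta ((base u)(K1 := Lx, K2 := Lx))) w)
       = (if w \<in> labs S' then split_op L K1 K2 F w else 0)" (is "sum ?h _ = _")
proof (cases "w \<in> labs S'")
  case False
  have "(base u)(K1 := x, K2 := y) \<noteq> w" for u x y
    using False S by (auto simp: labs_def base_def)
  then show ?thesis using False by (auto simp: delta_def intro!: sum.neutral) metis+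
next
  case True
  \<comment> \<open>Here the label of the one old circle is the only freedom.\<close>
  define g where "g s = w(K1 := L1, K2 := L1, L := s)" for s
  have gS: "range g \<subseteq> labs S" using True S C by (auto simp: g_def labs_def)
  have inj: "inj g"
    by (rule inj_on_inverseI[where g = "\<lambda>u. u L"]) (use C in \<open>auto simp: g_def\<close>)
  have zero: "?h u = 0" if u: "u \<in> labs S - range g" for u
  proof (rule ccontr)
    assume nz: "?h u \<noteq> 0"
    then obtain x y where w: "w = (base u)(K1 := x, K2 := y)"
      by (auto simp: delta_def split: if_splits)
    have "u = g (u L)"
    proof
      fix k
      show "u k = g (u L) k"
        using u S C by (auto simp: g_def w labs_def base_def)
    qed
    then show False using u by (metis DiffD2 rangeI)
  qed
  have val: "(base (g s))(K1 := x, K2 := y) = w(K1 := x, K2 := y)" for s x y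
    using True S C by (auto simp: g_def labs_def base_def)
  have d: "delta (w(K1 := x, K2 := y)) w = (if w K1 = x \<and> w K2 = y then 1 else 0 :: 'r)" for x y
  proof -
    have "w = w(K1 := x, K2 := y) \<longleftrightarrow> w K1 = x \<and> w K2 = y"
      using C(5) by (auto simp: fun_eq_iff)
    then show ?thesis by (simp add: delta_def)
  qed
  have gL: "g s L = s" for s using C by (auto simp: g_def)
  have "sum ?h (labs S) = sum ?h (range g)"
    using zero gS C S by (intro sum.mono_neutral_right finite_labs) auto
  also have "\<dots> = (\<Sum>s\<in>UNIV. ?h (g s))" using inj by (simp add: sum.reindex)
  also have "\<dots> = ?h (g L1) + ?h (g Lx)"
    unfolding UNIV_lab by simp
  also have "\<dots> = split_op L K1 K2 F w"
    unfolding gL val using d by (cases "w K1"; cases "w K2") (auto simp: split_op_def g_def)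
  finally show ?thesis using True by simp
qed

section \<open>The saddle cobordism\<close>

definition points :: "nat \<Rightarrow> (bool \<times> nat) set" where
  "points n = UNIV \<times> {0..<2*n}"

text \<open>The arcs of an intermediate diagram are given by two involutions of
  \<open>points n\<close>, one untouched by saddles and one altered by them, as
  \<open>surgery\<close> requires.\<close>

definition outer :: "matching \<Rightarrow> matching \<Rightarrow> bool \<times> nat \<Rightarrow> bool \<times> nat" where
  "outer a d p = (fst p, if fst p then d (snd p) else a (snd p))"

definition inner :: "matching \<Rightarrow> nat set \<Rightarrow> bool \<times> nat \<Rightarrow> bool \<times> nat" where
  "inner b P p = (if snd p \<in> P then (\<not> fst p, snd p) else (fst p, b (snd p)))"

lemma Cn_D:
  assumes "m \<in> Cn n" "i < 2 * n"
  shows "m i < 2 * n" "m i \<noteq> i" "m (m i) = i"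
  using assms by (auto simp: Cn_def is_matching_def)

lemma finite_points: "finite (points n)"
  by (simp add: points_def)

locale gluing =
  fixes n :: nat and a b d :: matching
  assumes a: "a \<in> Cn n" and b: "b \<in> Cn n" and d: "d \<in> Cn n"
begin

abbreviation "cmp P \<equiv> st_comp n a b d P"
abbreviation "cmps P \<equiv> st_comps n a b d P"

text \<open>Saddles use up whole arcs of \<open>b\<close>; this condition is what makes
  \<open>inner b P\<close> an involution.\<close>

definition closed :: "nat set \<Rightarrow> bool" where
  "closed P \<longleftrightarrow> (\<forall>i<2*n. i \<in> P \<longrightarrow> b i \<in> P)"

lemma closed_iff: "closed P \<Longrightarrow> i < 2 * n \<Longrightarrow> b i \<in> P \<longleftrightarrow> i \<in> P"
  using Cn_D[OF b] unfolding closed_def by metis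

lemma cmp_eq:
  assumes "closed P"
  shows "cmp P p = (arc_rel (points n) (outer a d) \<union> arc_rel (points n) (inner b P))\<^sup>* `` {p}"
proof -
  have "st_edges n a b d P \<union> (st_edges n a b d P)\<inverse> =
      arc_rel (points n) (outer a d) \<union> arc_rel (points n) (inner b P)" (is "?l = ?r")
  proof
    have "(x, y) \<in> ?r" if "(x, y) \<in> ?l" for x y
    proof -
      have "y = outer a d x \<or> y = inner b P x"
        using that Cn_D[OF a] Cn_D[OF b] Cn_D[OF d] closed_iff[OF assms]
        by (auto simp: st_edges_def outer_def inner_def)
      moreover have "x \<in> points n"
        using that Cn_D[OF a] Cn_D[OF b] Cn_D[OF d] by (auto simp: st_edges_def points_def)
      ultimately show ?thesis unfolding arc_rel_def by blast
    qed
    then show "?l \<subseteq> ?r" by auto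
    have "(x, outer a d x) \<in> ?l" "(x, inner b P x) \<in> ?l" if "x \<in> points n" for x
      using that by (cases x; cases "fst x"; auto simp: st_edges_def points_def outer_def inner_def)+
    then show "?r \<subseteq> ?l" unfolding arc_rel_def by blast
  qed
  then show ?thesis unfolding st_comp_def by auto
qed

lemma cmps_eq: "cmps P = cmp P ` points n"
  by (simp add: st_comps_def points_def)

text \<open>The colour is the parity of the point, reversed on the right-hand diagram. Arcs of
  \<open>a\<close>, \<open>b\<close> and \<open>d\<close> stay on one side and change parity; arcs
  created by saddles keep the point and change side.\<close>

lemma surgery:
  assumes "closed P" "i < 2 * n" "i \<notin> P"
  shows "surgery (points n) (outer a d) (inner b P) (inner b (P \<union> {i, b i})) (\<lambda>p. fst p \<noteq> even (snd p))
    (False, i) (False, b i) (True, i) (True, b i)"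
proof
  have bi: "b i < 2 * n" "b i \<noteq> i" "b (b i) = i" "b i \<notin> P"
    using assms Cn_D[OF b] closed_iff by auto
  show "outer a d x \<in> points n \<and> outer a d (outer a d x) = x \<and>
      (fst (outer a d x) \<noteq> even (snd (outer a d x))) \<noteq> (fst x \<noteq> even (snd x))" if "x \<in> points n" for x
    using that Cn_D[OF a] Cn_D[OF d] Cn_parity[OF a] Cn_parity[OF d]
    by (auto simp: outer_def points_def)
  show "inner b P x \<in> points n \<and> inner b P (inner b P x) = x \<and>
      (fst (inner b P x) \<noteq> even (snd (inner b P x))) \<noteq> (fst x \<noteq> even (snd x))" if "x \<in> points n" for x
    using that Cn_D[OF b] Cn_parity[OF b] closed_iff[OF assms(1)]
    by (auto simp: inner_def points_def)
  show "(fst (False, i) \<noteq> even (snd (False, i))) = (fst (True, b i) \<noteq> even (snd (True, b i)))"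
    using Cn_parity[OF b assms(2)] by auto
  show "inner b (P \<union> {i, b i}) x = inner b P x"
    if "x \<notin> {(False, i), (False, b i), (True, i), (True, b i)}" for x
    using that by (cases x) (auto simp: inner_def)
qed (use assms Cn_D[OF b assms(2)] closed_iff in \<open>auto simp: inner_def finite_points points_def\<close>)

lemma closed_step: "closed P \<Longrightarrow> i < 2 * n \<Longrightarrow> closed (P \<union> {i, b i})"
  using Cn_D[OF b] by (auto simp: closed_def)

text \<open>Every saddle is a merge or a genuine split, and \<open>step\<close> becomes the matching
  operator, truncated to labellings of the new diagram. The last clause of each case tracks the
  circle through a given point; \<open>step_mulx\<close> relies on it.\<close>

lemma saddle_cases:
  assumes "closed P" "i < 2 * n" "i \<notin> P"
  defines "P' \<equiv> P \<union> {i, b i}"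
  defines "L \<equiv> cmp P (False, i)" and "Rt \<equiv> cmp P (True, i)"
    and "K1 \<equiv> cmp P' (False, i)" and "K2 \<equiv> cmp P' (False, b i)"
  obtains (merge) C where "finite C" "L \<notin> C" "Rt \<notin> C" "K1 \<notin> C" "L \<noteq> Rt" "K1 \<noteq> L" "K1 \<noteq> Rt"
      "cmps P = C \<union> {L, Rt}" "cmps P' = C \<union> {K1}"
      "\<And>F :: slab \<Rightarrow> 'r::comm_ring_1. step n a b d P i F
          = (\<lambda>w. if w \<in> labs (cmps P') then merge_op L Rt K1 F w else 0)"
      "\<And>p. p \<in> points n \<Longrightarrow> cmp P p \<in> C \<and> cmp P' p = cmp P p \<or> cmp P p \<in> {L, Rt} \<and> cmp P' p = K1"
  | (split) C where "finite C" "L \<notin> C" "K1 \<notin> C" "K2 \<notin> C" "K1 \<noteq> K2" "K1 \<noteq> L" "K2 \<noteq> L"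
      "cmps P = C \<union> {L}" "cmps P' = C \<union> {K1, K2}"
      "\<And>F :: slab \<Rightarrow> 'r::comm_ring_1. step n a b d P i F
          = (\<lambda>w. if w \<in> labs (cmps P') then split_op L K1 K2 F w else 0)"
      "\<And>p. p \<in> points n \<Longrightarrow> cmp P p \<in> C \<and> cmp P' p = cmp P p \<or> cmp P p = L \<and> cmp P' p \<in> {K1, K2}"
proof -
  have closed': "closed P'" unfolding P'_def using assms closed_step by blast
  interpret s: surgery "points n" "outer a d" "inner b P" "inner b P'" "\<lambda>p. fst p \<noteq> even (snd p)"
    "(False, i)" "(False, b i)" "(True, i)" "(True, b i)"
    unfolding P'_def by (rule surgery[OF assms(1-3)])
  have E: "cmp P p = s.cmp p" for p unfolding cmp_eq[OF assms(1)] s.E_def ..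
  have E': "cmp P' p = s.cmp' p" for p unfolding cmp_eq[OF closed'] s.E'_def ..
  have fin: "finite s.others" unfolding s.others_def by (simp add: finite_points)
  have S: "cmps P = s.others \<union> {L, Rt}"
    using s.cmps_eq unfolding cmps_eq L_def Rt_def E .
  have S': "cmps P' = s.others \<union> {K1, K2}"
    using s.cmps'_eq unfolding cmps_eq K1_def K2_def E' .
  have mem: "cmp P p \<in> s.others \<and> cmp P' p = cmp P p \<or> cmp P p \<in> {L, Rt} \<and> cmp P' p \<in> {K1, K2}"
    if "p \<in> points n" for p
  proof (cases "p \<in> L \<union> Rt")
    case True
    then have "cmp P p \<in> {L, Rt}" unfolding L_def Rt_def E using s.cmp_eq_iff by blast
    moreover have "cmp P' p \<in> {K1, K2}"
      using True s.cmp'_eq_iff unfolding L_def Rt_def K1_def K2_def E E' s.union_eq by blast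
    ultimately show ?thesis by blast
  next
    case False
    then show ?thesis
      using that s.cmp_other[of p] unfolding L_def Rt_def E E' s.others_def by auto
  qed
  show ?thesis
  proof (cases "L = Rt")
    case False
    then have m: "K2 = K1" "K1 \<noteq> L" "K1 \<noteq> Rt"
      using s.merge_comps unfolding L_def Rt_def K1_def K2_def E E' by auto
    have no: "L \<notin> s.others" "Rt \<notin> s.others" "K1 \<notin> s.others"
      using s.cmps_notin_others s.cmps'_notin_others unfolding L_def Rt_def K1_def E E' by auto
    have S1': "cmps P' = s.others \<union> {K1}" using S' m(1) by simp
    have "step n a b d P i F = (\<lambda>w. if w \<in> labs (cmps P') then merge_op L Rt K1 F w else 0)"
      for F :: "slab \<Rightarrow> 'r"
      unfolding step_def saddle_def Let_def P'_def[symmetric] L_def[symmetric] Rt_def[symmetric]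
        K1_def[symmetric]
      using merge_op_eq_sum[OF fin no False m(2,3) S S1', of F] False by simp
    moreover have "cmp P p \<in> s.others \<and> cmp P' p = cmp P p \<or> cmp P p \<in> {L, Rt} \<and> cmp P' p = K1"
      if "p \<in> points n" for p using mem[OF that] m(1) by simp
    ultimately show ?thesis using merge[OF fin no False m(2,3) S S1'] by blast
  next
    case True
    then have m: "K1 \<noteq> K2" "K1 \<noteq> L" "K2 \<noteq> L"
      using s.split_comps unfolding L_def Rt_def K1_def K2_def E E' by auto
    have no: "L \<notin> s.others" "K1 \<notin> s.others" "K2 \<notin> s.others"
      using s.cmps_notin_others s.cmps'_notin_others unfolding L_def Rt_def K1_def K2_def E E' by auto
    have S1: "cmps P = s.others \<union> {L}" using S True by simp
    have "step n a b d P i F = (\<lambda>w. if w \<in> labs (cmps P') then split_op L K1 K2 F w else 0)"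
      for F :: "slab \<Rightarrow> 'r"
      unfolding step_def saddle_def Let_def P'_def[symmetric] L_def[symmetric] Rt_def[symmetric]
        K1_def[symmetric] K2_def[symmetric]
      using split_op_eq_sum[OF fin no m S1 S', of F] True by simp
    moreover have "cmp P p \<in> s.others \<and> cmp P' p = cmp P p \<or> cmp P p = L \<and> cmp P' p \<in> {K1, K2}"
      if "p \<in> points n" for p using mem[OF that] True by simp
    ultimately show ?thesis using split[OF fin no m S1 S'] by blast
  qed
qed

lemma step_ddx:
  fixes F :: "slab \<Rightarrow> 'r::comm_ring_1"
  assumes two: "\<And>x::'r. x + x = 0" and P: "closed P" "i < 2 * n" "i \<notin> P"
  shows "step n a b d P i (ddx (cmps P) F) = ddx (cmps (P \<union> {i, b i})) (step n a b d P i F)"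
  using P
proof (cases rule: saddle_cases[where 'r = 'r])
  case (merge C)
  show ?thesis
    unfolding merge(10) ddx_restrict
    unfolding merge(8,9) by (simp only: merge_ddx[OF two merge(1-7)])
next
  case (split C)
  show ?thesis
    unfolding split(10) ddx_restrict
    unfolding split(8,9) by (simp only: split_ddx[OF two split(1-7)])
qed

text \<open>The circle that carries the factor \<open>x\<close> is addressed by a point on it,
  because the circle itself may change from one stage to the next.\<close>

lemma step_mulx:
  fixes F :: "slab \<Rightarrow> 'r::comm_ring_1"
  assumes P: "closed P" "i < 2 * n" "i \<notin> P" and p: "p \<in> points n"
  shows "step n a b d P i (mulx (cmp P p) F) = mulx (cmp (P \<union> {i, b i}) p) (step n a b d P i F)"
proof -
  have mem: "cmp (P \<union> {i, b i}) p \<in> cmps (P \<union> {i, b i})" using p by (simp add: cmps_eq)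
  show ?thesis
    using P
  proof (cases rule: saddle_cases[where 'r = 'r])
    case (merge C)
    show ?thesis
      unfolding merge(10) mulx_restrict[OF mem]
      by (simp only: mulx_merge_op[OF merge(2-7) merge(11)[OF p]])
  next
    case (split C)
    show ?thesis
      unfolding split(10) mulx_restrict[OF mem]
      by (simp only: mulx_split_op[OF split(2-7) split(11)[OF p]])
  qed
qed

section \<open>Running all saddles of the cobordism\<close>

fun arcs_ok :: "nat set \<Rightarrow> nat list \<Rightarrow> bool" where
  "arcs_ok P [] \<longleftrightarrow> True"
| "arcs_ok P (i # is) \<longleftrightarrow> i < 2 * n \<and> i \<notin> P \<and> arcs_ok (P \<union> {i, b i}) is"

lemma arcs_ok_distinct:
  assumes "distinct is" "\<And>i. i \<in> set is \<Longrightarrow> i < b i \<and> i < 2 * n \<and> i \<notin> P"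
  shows "arcs_ok P is"
  using assms
proof (induction "is" arbitrary: P)
  case (Cons i "is")
  \<comment> \<open>An arc is listed by its lower end, so a later entry cannot be the upper end of
    an earlier arc.\<close>
  have "j \<notin> P \<union> {i, b i}" if "j \<in> set is" for j
  proof -
    have "j \<noteq> i" "i < b i" "j < b j" "i < 2 * n" "j \<notin> P" using Cons.prems that by auto
    then show ?thesis using Cn_D(3)[OF b, of i] by auto
  qed
  then show ?case using Cons.prems Cons.IH[of "P \<union> {i, b i}"] by auto
qed simp

lemma arcs_ok_arcs_list: "arcs_ok {} (arcs_list n b)"
  by (rule arcs_ok_distinct) (auto simp: arcs_list_def)

lemma arcs_list_covers: "(\<Union>i\<in>set (arcs_list n b). {i, b i}) = {0..<2*n}"
proof
  show "(\<Union>i\<in>set (arcs_list n b). {i, b i}) \<subseteq> {0..<2*n}"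
    using Cn_D[OF b] by (auto simp: arcs_list_def)
  have "j \<in> (\<Union>i\<in>set (arcs_list n b). {i, b i})" if "j < 2 * n" for j
  proof -
    note bj = Cn_D[OF b that]
    have "j \<in> set (arcs_list n b) \<or> b j \<in> set (arcs_list n b)"
      using bj that by (auto simp: arcs_list_def)
    then show ?thesis using bj(3) by (metis UN_iff insertCI)
  qed
  then show "{0..<2*n} \<subseteq> (\<Union>i\<in>set (arcs_list n b). {i, b i})" by auto
qed

lemma run_ddx:
  fixes F :: "slab \<Rightarrow> 'r::comm_ring_1"
  assumes two: "\<And>x::'r. x + x = 0" and "closed P" "arcs_ok P is"
  shows "run n a b d P is (ddx (cmps P) F)
    = ddx (cmps (P \<union> (\<Union>i\<in>set is. {i, b i}))) (run n a b d P is F)"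
  using assms(2,3)
proof (induction "is" arbitrary: P F)
  case (Cons i "is")
  have "P \<union> (\<Union>j\<in>set (i # is). {j, b j}) = P \<union> {i, b i} \<union> (\<Union>j\<in>set is. {j, b j})" by auto
  moreover have i: "i < 2 * n" "i \<notin> P" "arcs_ok (P \<union> {i, b i}) is" using Cons.prems by auto
  ultimately show ?case
    by (simp only: run.simps step_ddx[OF two Cons.prems(1) i(1,2)]
        Cons.IH[OF closed_step[OF Cons.prems(1) i(1)] i(3)])
qed simp

lemma run_mulx:
  fixes F :: "slab \<Rightarrow> 'r::comm_ring_1"
  assumes "closed P" "arcs_ok P is" "p \<in> points n"
  shows "run n a b d P is (mulx (cmp P p) F)
    = mulx (cmp (P \<union> (\<Union>i\<in>set is. {i, b i})) p) (run n a b d P is F)"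
  using assms(1,2)
proof (induction "is" arbitrary: P F)
  case (Cons i "is")
  have "P \<union> (\<Union>j\<in>set (i # is). {j, b j}) = P \<union> {i, b i} \<union> (\<Union>j\<in>set is. {j, b j})" by auto
  moreover have i: "i < 2 * n" "i \<notin> P" "arcs_ok (P \<union> {i, b i}) is" using Cons.prems by auto
  ultimately show ?case
    by (simp only: run.simps step_mulx[OF Cons.prems(1) i(1,2) assms(3)]
        Cons.IH[OF closed_step[OF Cons.prems(1) i(1)] i(3)])
qed simp

lemma run_sum:
  fixes F :: "'i \<Rightarrow> slab \<Rightarrow> 'r::comm_ring_1"
  shows "run n a b d P is (\<lambda>u. \<Sum>x\<in>A. c x * F x u) w = (\<Sum>x\<in>A. c x * run n a b d P is (F x) w)"
proof (induction "is" arbitrary: P F w)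
  case (Cons i "is")
  have "step n a b d P i (\<lambda>u. \<Sum>x\<in>A. c x * F x u) = (\<lambda>u. \<Sum>x\<in>A. c x * step n a b d P i (F x) u)"
    unfolding step_def sum_distrib_left sum_distrib_right
    by (subst sum.swap) (simp add: mult.assoc)
  then show ?case using Cons.IH by simp
qed simp

end

section \<open>Circles of glued matchings as components of the initial and final diagrams\<close>

lemma circ_eq:
  assumes "a \<in> Cn n" "b \<in> Cn n"
  shows "circ n a b i = (arc_rel {0..<2*n} a \<union> arc_rel {0..<2*n} b)\<^sup>* `` {i}"
proof -
  have "glue_edges n a b \<union> (glue_edges n a b)\<inverse> = arc_rel {0..<2*n} a \<union> arc_rel {0..<2*n} b"
    (is "?l = ?r")
  proof
    have "(x, y) \<in> ?r" if "(x, y) \<in> ?l" for x y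
    proof -
      have "(y = a x \<or> y = b x) \<and> x < 2 * n"
        using that Cn_D[OF assms(1)] Cn_D[OF assms(2)] by (auto simp: glue_edges_def)
      then show ?thesis by (auto simp: arc_rel_def)
    qed
    then show "?l \<subseteq> ?r" by auto
    show "?r \<subseteq> ?l" by (auto simp: arc_rel_def glue_edges_def)
  qed
  then show ?thesis unfolding circ_def by auto
qed

lemma circ_closed:
  assumes "a \<in> Cn n" "b \<in> Cn n" "j \<in> circ n a b i" "j < 2 * n"
  shows "a j \<in> circ n a b i" "b j \<in> circ n a b i"
proof -
  have "(j, a j) \<in> arc_rel {0..<2*n} a" "(j, b j) \<in> arc_rel {0..<2*n} b"
    using assms by (auto simp: arc_rel_def)
  then show "a j \<in> circ n a b i" "b j \<in> circ n a b i"
    using assms(3) unfolding circ_eq[OF assms(1,2)] by (auto intro: rtrancl_into_rtrancl)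
qed

lemma circ_refl: "i \<in> circ n a b i"
  by (simp add: circ_def)

lemma finite_circles: "finite (circles n a b)"
  by (simp add: circles_def)

lemma circles_nonempty: "\<kappa> \<in> circles n a' b' \<Longrightarrow> \<kappa> \<noteq> {}"
  unfolding circles_def using circ_refl by blast

lemma inj_Pair_image: "(Pair s ` \<kappa> = Pair s ` \<kappa>') \<longleftrightarrow> \<kappa> = \<kappa>'"
  by (auto simp: inj_image_eq_iff inj_on_def)

context gluing
begin

lemma cmp_outer_inner:
  assumes "closed P" "q \<in> cmp P p" "q \<in> points n"
  shows "outer a d q \<in> cmp P p" "inner b P q \<in> cmp P p"
proof -
  have "(q, outer a d q) \<in> arc_rel (points n) (outer a d)" "(q, inner b P q) \<in> arc_rel (points n) (inner b P)"
    using assms(3) unfolding arc_rel_def by blast+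
  then show "outer a d q \<in> cmp P p" "inner b P q \<in> cmp P p"
    using assms(2) unfolding cmp_eq[OF assms(1)] by (auto intro: rtrancl_into_rtrancl)
qed

lemma cmp_subset:
  assumes "closed P" "p \<in> A"
    and "\<And>q. q \<in> A \<Longrightarrow> q \<in> points n \<Longrightarrow> outer a d q \<in> A \<and> inner b P q \<in> A"
  shows "cmp P p \<subseteq> A"
proof -
  have "(arc_rel (points n) (outer a d) \<union> arc_rel (points n) (inner b P)) `` A \<subseteq> A"
    using assms(3) unfolding arc_rel_def by blast
  then show ?thesis
    unfolding cmp_eq[OF assms(1)] using Image_closed_trancl[of _ A] assms(2) by blast
qed

lemma closed_empty: "closed {}" and closed_all: "closed {0..<2*n}"
  using Cn_D[OF b] by (auto simp: closed_def)

lemma cmp_empty_False: "cmp {} (False, i) = Pair False ` circ n a b i"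
proof
  show "cmp {} (False, i) \<subseteq> Pair False ` circ n a b i"
    by (rule cmp_subset[OF closed_empty])
      (use circ_closed[OF a b] circ_refl in \<open>auto simp: outer_def inner_def points_def\<close>)
  have "(False, j) \<in> cmp {} (False, i)"
    if "(i, j) \<in> (arc_rel {0..<2*n} a \<union> arc_rel {0..<2*n} b)\<^sup>*" for j
    using that
  proof induction
    case base
    show ?case by (simp add: st_comp_def)
  next
    case (step j k)
    then have "j < 2 * n" "k = a j \<or> k = b j" by (auto simp: arc_rel_def)
    then show ?case using cmp_outer_inner[OF closed_empty step.IH]
      by (auto simp: outer_def inner_def points_def)
  qed
  then show "Pair False ` circ n a b i \<subseteq> cmp {} (False, i)"
    unfolding circ_eq[OF a b] by auto
qed

lemma cmp_empty_True: "cmp {} (True, i) = Pair True ` circ n b d i"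
proof
  show "cmp {} (True, i) \<subseteq> Pair True ` circ n b d i"
    by (rule cmp_subset[OF closed_empty])
      (use circ_closed[OF b d] circ_refl in \<open>auto simp: outer_def inner_def points_def\<close>)
  have "(True, j) \<in> cmp {} (True, i)"
    if "(i, j) \<in> (arc_rel {0..<2*n} b \<union> arc_rel {0..<2*n} d)\<^sup>*" for j
    using that
  proof induction
    case base
    show ?case by (simp add: st_comp_def)
  next
    case (step j k)
    then have "j < 2 * n" "k = b j \<or> k = d j" by (auto simp: arc_rel_def)
    then show ?case using cmp_outer_inner[OF closed_empty step.IH]
      by (auto simp: outer_def inner_def points_def)
  qed
  then show "Pair True ` circ n b d i \<subseteq> cmp {} (True, i)"
    unfolding circ_eq[OF b d] by auto
qed

text \<open>After all saddles the two copies of every point are joined to each other, so a component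
  consists of both copies of a circle of the left matching \<open>a\<close> glued to the right
  matching \<open>d\<close>.\<close>

lemma cmp_all:
  assumes "i < 2 * n"
  shows "cmp {0..<2*n} (s, i) = UNIV \<times> circ n a d i"
proof
  let ?Q = "{0..<2*n}"
  show "cmp ?Q (s, i) \<subseteq> UNIV \<times> circ n a d i"
    by (rule cmp_subset[OF closed_all])
      (use circ_closed[OF a d] circ_refl in \<open>auto simp: outer_def inner_def points_def\<close>)
  \<comment> \<open>The arc created by the saddle at \<open>j\<close> leads from one copy of
    \<open>j\<close> to the other.\<close>
  have flip: "(x, j) \<in> cmp ?Q (s, i)" if "(y, j) \<in> cmp ?Q (s, i)" "j < 2 * n" for x y j
    using cmp_outer_inner(2)[OF closed_all that(1)] that
    by (cases "x = y") (auto simp: inner_def points_def)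
  have "j < 2 * n \<and> (\<forall>x. (x, j) \<in> cmp ?Q (s, i))"
    if "(i, j) \<in> (arc_rel ?Q a \<union> arc_rel ?Q d)\<^sup>*" for j
    using that
  proof induction
    case base
    have "(s, i) \<in> cmp ?Q (s, i)" by (simp add: st_comp_def)
    then show ?case using flip assms by blast
  next
    case (step j k)
    then have j: "j < 2 * n" "k = a j \<or> k = d j" "(x, j) \<in> points n" for x
      by (auto simp: arc_rel_def points_def)
    then have k: "k < 2 * n" using Cn_D[OF a] Cn_D[OF d] by auto
    have "outer a d (x, j) \<in> cmp ?Q (s, i)" for x
      using cmp_outer_inner(1)[OF closed_all _ j(3)] step.IH by blast
    from this[of True] this[of False] have "\<exists>x. (x, k) \<in> cmp ?Q (s, i)"
      using j(2) by (auto simp: outer_def)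
    then show ?case using flip k by blast
  qed
  then show "UNIV \<times> circ n a d i \<subseteq> cmp ?Q (s, i)"
    unfolding circ_eq[OF a d] by auto
qed

lemma cmps_empty: "cmps {} = (`) (Pair False) ` circles n a b \<union> (`) (Pair True) ` circles n b d"
proof -
  have "points n = Pair False ` {0..<2*n} \<union> Pair True ` {0..<2*n}"
    unfolding points_def UNIV_bool by auto
  then show ?thesis
    unfolding cmps_eq circles_def by (simp add: image_Un image_image cmp_empty_False cmp_empty_True)
qed

lemma cmps_all: "cmps {0..<2*n} = (\<lambda>\<kappa>. UNIV \<times> \<kappa>) ` circles n a d"
proof -
  have "cmps {0..<2*n} = (\<lambda>(s, i). UNIV \<times> circ n a d i) ` points n"
    unfolding cmps_eq by (intro image_cong) (auto simp: points_def cmp_all)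
  then show ?thesis unfolding circles_def points_def by force
qed

section \<open>Labellings of the initial and final diagrams, and the product through one middle
  matching\<close>

definition lft :: "slab \<Rightarrow> nat set \<Rightarrow> lab" where
  "lft u = (\<lambda>\<kappa>. if \<kappa> \<in> circles n a b then u (Pair False ` \<kappa>) else L1)"

definition rgt :: "slab \<Rightarrow> nat set \<Rightarrow> lab" where
  "rgt u = (\<lambda>\<kappa>. if \<kappa> \<in> circles n b d then u (Pair True ` \<kappa>) else L1)"

text \<open>The labelling \<open>u0\<close> inside \<open>bprod\<close>; before any saddle a
  component with a \<open>False\<close> point lies entirely on the left.\<close>

definition join :: "(nat set \<Rightarrow> lab) \<Rightarrow> (nat set \<Rightarrow> lab) \<Rightarrow> slab" where
  "join v w = (\<lambda>K. if K \<in> cmps {}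
      then (if (\<exists>p\<in>K. \<not> fst p) then v (snd ` K) else w (snd ` K)) else L1)"

text \<open>The labelling of the final diagram at which \<open>bprod\<close> reads off its
  coefficient.\<close>

definition fin :: "(nat set \<Rightarrow> lab) \<Rightarrow> slab" where
  "fin v = (\<lambda>K. if K \<in> cmps {0..<2*n} then v (snd ` K) else L1)"

definition tens :: "((nat set \<Rightarrow> lab) \<Rightarrow> 'r) \<Rightarrow> ((nat set \<Rightarrow> lab) \<Rightarrow> 'r) \<Rightarrow> slab \<Rightarrow> 'r::comm_ring_1" where
  "tens f g u = (if u \<in> labs (cmps {}) then f (lft u) * g (rgt u) else 0)"

definition glue_prod :: "((nat set \<Rightarrow> lab) \<Rightarrow> 'r) \<Rightarrow> ((nat set \<Rightarrow> lab) \<Rightarrow> 'r)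
    \<Rightarrow> (nat set \<Rightarrow> lab) \<Rightarrow> 'r::comm_ring_1" where
  "glue_prod f g v = run n a b d {} (arcs_list n b) (tens f g) (fin v)"

text \<open>The empty set has the same image under both maps, so it is nonemptiness of circles that
  separates left from right.\<close>

lemma Pair_image_neq:
  "\<kappa> \<in> circles n a' b' \<Longrightarrow> Pair False ` \<kappa> \<noteq> Pair True ` \<kappa>'"
  using circles_nonempty[of \<kappa> n a' b'] by auto

lemma lft_upd:
  assumes "\<kappa> \<in> circles n a b"
  shows "lft (u(Pair False ` \<kappa> := x)) = (lft u)(\<kappa> := x)" "rgt (u(Pair False ` \<kappa> := x)) = rgt u"
  using assms circles_nonempty[OF assms]
  by (auto simp: lft_def rgt_def fun_eq_iff inj_Pair_image)

lemma rgt_upd: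
  assumes "\<kappa> \<in> circles n b d"
  shows "rgt (u(Pair True ` \<kappa> := x)) = (rgt u)(\<kappa> := x)" "lft (u(Pair True ` \<kappa> := x)) = lft u"
  using assms by (auto simp: lft_def rgt_def fun_eq_iff inj_Pair_image Pair_image_neq)

lemma lft_rgt_labs: "lft u \<in> labs (circles n a b)" "rgt u \<in> labs (circles n b d)"
  by (auto simp: lft_def rgt_def labs_def)

lemma join_False: "\<kappa> \<in> circles n a b \<Longrightarrow> join v w (Pair False ` \<kappa>) = v \<kappa>"
  using circles_nonempty[of \<kappa>] by (auto simp: join_def cmps_empty image_image)

lemma join_True: "\<kappa> \<in> circles n b d \<Longrightarrow> join v w (Pair True ` \<kappa>) = w \<kappa>"
  by (auto simp: join_def cmps_empty image_image)

lemma join_eq_iff: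
  assumes "v \<in> labs (circles n a b)" "w \<in> labs (circles n b d)"
  shows "u = join v w \<longleftrightarrow> u \<in> labs (cmps {}) \<and> v = lft u \<and> w = rgt u"
proof
  assume u: "u = join v w"
  show "u \<in> labs (cmps {}) \<and> v = lft u \<and> w = rgt u"
    using assms unfolding u
    by (auto simp: lft_def rgt_def labs_def fun_eq_iff join_False join_True) (simp add: join_def)
next
  assume u: "u \<in> labs (cmps {}) \<and> v = lft u \<and> w = rgt u"
  show "u = join v w"
  proof
    fix K
    show "u K = join v w K"
    proof (cases "K \<in> cmps {}")
      case True
      then show ?thesis using u by (auto simp: cmps_empty join_False join_True lft_def rgt_def)
    qed (use u in \<open>auto simp: join_def labs_def\<close>)
  qed
qed

lemma tens_eq_sum:
  fixes f g :: "(nat set \<Rightarrow> lab) \<Rightarrow> 'r::comm_ring_1"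
  shows "tens f g = (\<lambda>u. \<Sum>(v, w)\<in>labs (circles n a b) \<times> labs (circles n b d).
      f v * g w * delta (join v w) u)"
proof
  fix u
  let ?A = "labs (circles n a b) \<times> labs (circles n b d)"
  have "(\<Sum>(v, w)\<in>?A. f v * g w * delta (join v w) u)
      = (\<Sum>z\<in>?A. if z = (lft u, rgt u) then tens f g u else 0)"
    by (intro sum.cong refl) (auto simp: delta_def join_eq_iff tens_def split: if_splits)
  also have "\<dots> = tens f g u"
    using lft_rgt_labs by (subst sum.delta) (auto simp: finite_labs finite_circles)
  finally show "tens f g u = (\<Sum>(v, w)\<in>?A. f v * g w * delta (join v w) u)" ..
qed

lemma sum_bprod:
  fixes f g :: "(nat set \<Rightarrow> lab) \<Rightarrow> 'r::comm_ring_1"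
  assumes "v' \<in> labs (circles n a d)"
  shows "(\<Sum>(v, w)\<in>labs (circles n a b) \<times> labs (circles n b d).
      f v * g w * bprod n (a, b, v) (b, d, w) (a, d, v')) = glue_prod f g v'"
proof -
  have "bprod n (a, b, v) (b, d, w) (a, d, v')
      = (run n a b d {} (arcs_list n b) (delta (join v w)) (fin v') :: 'r)" for v w
    using assms by (simp add: bprod_def Let_def join_def fin_def)
  then show ?thesis
    unfolding glue_prod_def tens_eq_sum case_prod_unfold
    using run_sum[of "{}" "arcs_list n b" "\<lambda>z. f (fst z) * g (snd z)" "\<lambda>z. delta (join (fst z) (snd z))"]
    by simp
qed

text \<open>Each circle of the disjoint union belongs to exactly one factor, so the sum over circles
  splits into the two Leibniz terms.\<close>

lemma ddx_tens:
  fixes f g :: "(nat set \<Rightarrow> lab) \<Rightarrow> 'r::comm_ring_1"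
  shows "ddx (cmps {}) (tens f g)
    = (\<lambda>u. tens (ddx (circles n a b) f) g u + tens f (ddx (circles n b d) g) u)"
proof -
  have disj: "(`) (Pair False) ` circles n a b \<inter> (`) (Pair True) ` circles n b d = {}"
    using Pair_image_neq by blast
  have inj: "inj_on ((`) (Pair s)) A" for s :: bool and A :: "nat set set"
    by (auto simp: inj_on_def inj_Pair_image)
  have "ddx (cmps {}) (\<lambda>u. f (lft u) * g (rgt u)) u
      = ddx (circles n a b) f (lft u) * g (rgt u) + f (lft u) * ddx (circles n b d) g (rgt u)" for u
  proof -
    have 1: "unx (Pair False ` \<kappa>) (\<lambda>u. f (lft u) * g (rgt u)) u = unx \<kappa> f (lft u) * g (rgt u)"
      if "\<kappa> \<in> circles n a b" for \<kappa>
      using that by (simp add: unx_def lft_upd) (simp add: lft_def)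
    have 2: "unx (Pair True ` \<kappa>) (\<lambda>u. f (lft u) * g (rgt u)) u = f (lft u) * unx \<kappa> g (rgt u)"
      if "\<kappa> \<in> circles n b d" for \<kappa>
      using that by (simp add: unx_def rgt_upd) (simp add: rgt_def)
    show ?thesis
      unfolding ddx_def cmps_empty
      by (simp add: sum.union_disjoint[OF _ _ disj] finite_circles sum.reindex[OF inj] 1 2
          sum_distrib_left sum_distrib_right cong: sum.cong)
  qed
  then show ?thesis
    unfolding tens_def ddx_restrict by auto
qed

lemma mulx_tens_left:
  assumes "\<kappa> \<in> circles n a b"
  shows "mulx (Pair False ` \<kappa>) (tens f g) = tens (mulx \<kappa> f) g"
proof -
  have mem: "Pair False ` \<kappa> \<in> cmps {}" using assms by (simp add: cmps_empty)
  have "mulx (Pair False ` \<kappa>) (\<lambda>u. f (lft u) * g (rgt u)) u = mulx \<kappa> f (lft u) * g (rgt u)" for u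
    using assms by (simp add: mulx_def lft_upd) (simp add: lft_def)
  then show ?thesis unfolding tens_def mulx_restrict[OF mem] by auto
qed

lemma mulx_tens_right:
  assumes "\<kappa> \<in> circles n b d"
  shows "mulx (Pair True ` \<kappa>) (tens f g) = tens f (mulx \<kappa> g)"
proof -
  have mem: "Pair True ` \<kappa> \<in> cmps {}" using assms by (simp add: cmps_empty)
  have "mulx (Pair True ` \<kappa>) (\<lambda>u. f (lft u) * g (rgt u)) u = f (lft u) * mulx \<kappa> g (rgt u)" for u
    using assms by (simp add: mulx_def rgt_upd) (simp add: rgt_def)
  then show ?thesis unfolding tens_def mulx_restrict[OF mem] by auto
qed

lemma fin_upd:
  assumes "\<kappa> \<in> circles n a d"
  shows "fin (v(\<kappa> := x)) = (fin v)(UNIV \<times> \<kappa> := x)"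
proof
  fix K
  have "snd ` (UNIV \<times> \<kappa>') = \<kappa>'" for \<kappa>' :: "nat set" by force
  then show "fin (v(\<kappa> := x)) K = ((fin v)(UNIV \<times> \<kappa> := x)) K"
    using assms by (auto simp: fin_def cmps_all)
qed

lemma fin_apply: "\<kappa> \<in> circles n a d \<Longrightarrow> fin v (UNIV \<times> \<kappa>) = v \<kappa>"
  by (auto simp: fin_def cmps_all)

lemma ddx_fin: "ddx (cmps {0..<2*n}) F (fin v) = ddx (circles n a d) (\<lambda>v. F (fin v)) v"
proof -
  have "inj_on (\<lambda>\<kappa>. (UNIV :: bool set) \<times> \<kappa>) (circles n a d)"
    by (rule inj_on_inverseI[where g = "\<lambda>K. snd ` K"]) auto
  then show ?thesis
    unfolding ddx_def cmps_all
    by (auto simp: sum.reindex unx_def fin_upd fin_apply intro!: sum.cong)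
qed

lemma mulx_fin:
  "\<kappa> \<in> circles n a d \<Longrightarrow> mulx (UNIV \<times> \<kappa>) F (fin v) = mulx \<kappa> (\<lambda>v. F (fin v)) v"
  by (simp add: mulx_def fin_upd fin_apply)

lemma run_add:
  "run n a b d P is (\<lambda>u. F u + G u) = (\<lambda>w. run n a b d P is F w + run n a b d P is G w)"
proof (induction "is" arbitrary: P F G)
  case (Cons i "is")
  have "step n a b d P i (\<lambda>u. F u + G u) = (\<lambda>w. step n a b d P i F w + step n a b d P i G w)"
    by (simp add: step_def distrib_right sum.distrib)
  then show ?case using Cons.IH by simp
qed simp

lemmas run_all_ddx = run_ddx[OF _ closed_empty arcs_ok_arcs_list, unfolded arcs_list_covers Un_empty_left]
lemmas run_all_mulx = run_mulx[OF closed_empty arcs_ok_arcs_list, unfolded arcs_list_covers Un_empty_left]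

lemma ddx_glue_prod:
  fixes f g :: "(nat set \<Rightarrow> lab) \<Rightarrow> 'r::comm_ring_1"
  assumes two: "\<And>x::'r. x + x = 0"
  shows "ddx (circles n a d) (glue_prod f g) v
    = glue_prod (ddx (circles n a b) f) g v + glue_prod f (ddx (circles n b d) g) v"
  unfolding glue_prod_def ddx_fin[symmetric] run_all_ddx[OF two, symmetric] ddx_tens run_add ..

text \<open>Both copies of point 0 end up on the marked circle of the result. Tracking the left copy
  through the saddles gives the first equation, tracking the right copy the second.\<close>

lemma mulx_glue_prod:
  assumes "1 \<le> n"
  shows "mulx (kappa0 n a d) (glue_prod f g) v = glue_prod (mulx (kappa0 n a b) f) g v"
    and "mulx (kappa0 n a d) (glue_prod f g) v = glue_prod f (mulx (kappa0 n b d) g) v"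
proof -
  have mem: "kappa0 n a' b' \<in> circles n a' b'" for a' b'
    using assms by (simp add: kappa0_def circles_def)
  have p: "(s, 0) \<in> points n" for s using assms by (simp add: points_def)
  have c: "cmp {0..<2*n} (s, 0) = UNIV \<times> kappa0 n a d" for s
    using assms by (simp add: cmp_all kappa0_def)
  have c0: "cmp {} (False, 0) = Pair False ` kappa0 n a b" "cmp {} (True, 0) = Pair True ` kappa0 n b d"
    by (simp_all add: cmp_empty_False cmp_empty_True kappa0_def)
  show "mulx (kappa0 n a d) (glue_prod f g) v = glue_prod (mulx (kappa0 n a b) f) g v"
    unfolding glue_prod_def mulx_fin[OF mem, symmetric] mulx_tens_left[OF mem, symmetric]
    using run_all_mulx[OF p[of False]] unfolding c c0 by metis
  show "mulx (kappa0 n a d) (glue_prod f g) v = glue_prod f (mulx (kappa0 n b d) g) v"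
    unfolding glue_prod_def mulx_fin[OF mem, symmetric] mulx_tens_right[OF mem, symmetric]
    using run_all_mulx[OF p[of True]] unfolding c c0 by metis
qed

end

section \<open>The arc algebra\<close>

lemma finite_Cn: "finite (Cn n)"
proof -
  let ?A = "{0..<2*n}"
  \<comment> \<open>The value 0 off \<open>?A\<close> is a placeholder, exchanged below for the
    identity that matchings have there.\<close>
  let ?G = "{g. \<forall>x. (x \<in> ?A \<longrightarrow> g x \<in> ?A) \<and> (x \<notin> ?A \<longrightarrow> g x = 0)}"
  have "Cn n \<subseteq> (\<lambda>g x. if x < 2 * n then g x else x) ` ?G"
  proof
    fix m assume "m \<in> Cn n"
    then have "m = (\<lambda>x. if x < 2 * n then (\<lambda>x. if x < 2 * n then m x else 0) x else x)"
      "(\<lambda>x. if x < 2 * n then m x else 0) \<in> ?G"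
      by (auto simp: Cn_def is_matching_def)
    then show "m \<in> (\<lambda>g x. if x < 2 * n then g x else x) ` ?G" by (rule image_eqI)
  qed
  moreover have "finite ?G" by (rule finite_set_of_finite_funs) auto
  ultimately show ?thesis using finite_subset by blast
qed

lemma finite_Hbasis: "finite (Hbasis n)"
proof -
  have "Hbasis n = (SIGMA a:Cn n. SIGMA b:Cn n. labs (circles n a b))"
    by (auto simp: Hbasis_def)
  then show ?thesis by (auto intro!: finite_SigmaI simp: finite_Cn finite_labs finite_circles)
qed

lemma Hred_basis_iff: "(a, b, v) \<in> Hred_basis n \<longleftrightarrow> (a, b, v) \<in> Hbasis n \<and> v (kappa0 n a b) = L1"
  by (simp add: Hred_basis_def)

lemma finite_Hred_basis: "finite (Hred_basis n)"
  using finite_Hbasis finite_subset[of "Hred_basis n" "Hbasis n"] by (auto simp: Hred_basis_def)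

lemma kappa0_in_circles: "1 \<le> n \<Longrightarrow> kappa0 n a b \<in> circles n a b"
  by (simp add: kappa0_def circles_def)

lemma Hbasis_upd: "\<kappa> \<in> circles n a b \<Longrightarrow> (a, b, v(\<kappa> := s)) \<in> Hbasis n \<longleftrightarrow> (a, b, v) \<in> Hbasis n"
  by (auto simp: Hbasis_def upd_labs)

section \<open>The operators \<open>D\<close> and \<open>X\<close> on the arc algebra\<close>

definition H_ddx :: "nat \<Rightarrow> (hbasis \<Rightarrow> 'r::comm_ring_1) \<Rightarrow> hbasis \<Rightarrow> 'r" where
  "H_ddx n f = (\<lambda>(a, b, v). ddx (circles n a b) (\<lambda>v. f (a, b, v)) v)"

definition H_mulx :: "nat \<Rightarrow> (hbasis \<Rightarrow> 'r::comm_ring_1) \<Rightarrow> hbasis \<Rightarrow> 'r" where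
  "H_mulx n f = (\<lambda>(a, b, v). mulx (kappa0 n a b) (\<lambda>v. f (a, b, v)) v)"

lemma H_ddx_carrier: "f \<in> H_carrier n \<Longrightarrow> H_ddx n f \<in> H_carrier n"
  by (auto simp: H_carrier_def H_ddx_def ddx_def unx_def Hbasis_upd intro!: sum.neutral)

lemma H_mulx_carrier: "1 \<le> n \<Longrightarrow> f \<in> H_carrier n \<Longrightarrow> H_mulx n f \<in> H_carrier n"
  by (auto simp: H_carrier_def H_mulx_def mulx_def Hbasis_upd kappa0_in_circles)

text \<open>The condition on \<open>v'\<close> is kept as the outer conditional so that
  \<open>ddx_restrict\<close> and \<open>mulx_restrict\<close> match; what remains is a sum over the
  common middle matching of composable pairs.\<close>

lemma Hmult_eq:
  fixes f g :: "hbasis \<Rightarrow> 'r::comm_ring_1"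
  shows "Hmult n f g (a, d, v') = (if v' \<in> labs (circles n a d) then
      if a \<in> Cn n \<and> d \<in> Cn n
      then \<Sum>b\<in>Cn n. gluing.glue_prod n a b d (\<lambda>v. f (a, b, v)) (\<lambda>w. g (b, d, w)) v' else 0 else 0)"
proof (cases "(a, d, v') \<in> Hbasis n")
  case False
  have "bprod n e1 e2 (a, d, v') = (0 :: 'r)" if "e1 \<in> Hbasis n" "e2 \<in> Hbasis n" for e1 e2
    using that False by (auto simp: bprod_def Hbasis_def Let_def split: prod.splits)
  then show ?thesis using False by (auto simp: Hmult_def Hbasis_def)
next
  case True
  then have ad: "a \<in> Cn n" "d \<in> Cn n" "v' \<in> labs (circles n a d)" by (auto simp: Hbasis_def)
  let ?T = "SIGMA b:Cn n. labs (circles n a b) \<times> labs (circles n b d)"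
  let ?h = "\<lambda>(e1, e2). f e1 * g e2 * bprod n e1 e2 (a, d, v')"
  \<comment> \<open>A composable pair with outer matchings \<open>a\<close> and \<open>d\<close>
    amounts to a middle matching and two labellings.\<close>
  define j where "j = (\<lambda>(b, v, w). ((a, b, v), (b :: matching, d, w :: nat set \<Rightarrow> lab)) :: hbasis \<times> hbasis)"
  have inj: "inj_on j ?T" by (auto simp: j_def inj_on_def)
  have zero: "?h z = 0" if "z \<in> Hbasis n \<times> Hbasis n - j ` ?T" for z
  proof -
    obtain a1 b1 v c d1 w where z: "z = ((a1, b1, v), (c, d1, w))" by (metis prod.exhaust)
    have "\<not> (a1 = a \<and> d1 = d \<and> b1 = c)"
    proof
      assume "a1 = a \<and> d1 = d \<and> b1 = c"
      then have "z = j (b1, v, w)" "(b1, v, w) \<in> ?T" using that z by (auto simp: j_def Hbasis_def)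
      then show False using that by blast
    qed
    then show ?thesis unfolding z by (auto simp: bprod_def Let_def)
  qed
  have "Hmult n f g (a, d, v') = sum ?h (Hbasis n \<times> Hbasis n)"
    unfolding Hmult_def sum.cartesian_product ..
  also have "\<dots> = sum ?h (j ` ?T)"
  proof (rule sum.mono_neutral_right)
    show "j ` ?T \<subseteq> Hbasis n \<times> Hbasis n" using ad by (auto simp: j_def Hbasis_def)
  qed (use zero in \<open>auto simp: finite_Hbasis\<close>)
  also have "\<dots> = (\<Sum>z\<in>?T. ?h (j z))" using inj by (simp add: sum.reindex)
  also have "\<dots> = (\<Sum>b\<in>Cn n. \<Sum>z\<in>labs (circles n a b) \<times> labs (circles n b d). ?h (j (b, z)))"
    by (subst sum.Sigma) (auto simp: finite_Cn finite_labs finite_circles)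
  also have "\<dots> = (\<Sum>b\<in>Cn n. gluing.glue_prod n a b d (\<lambda>v. f (a, b, v)) (\<lambda>w. g (b, d, w)) v')"
  proof (rule sum.cong[OF refl])
    fix b assume "b \<in> Cn n"
    then interpret gluing n a b d by unfold_locales (use ad in auto)
    show "(\<Sum>z\<in>labs (circles n a b) \<times> labs (circles n b d). ?h (j (b, z)))
      = glue_prod (\<lambda>v. f (a, b, v)) (\<lambda>w. g (b, d, w)) v'"
      unfolding sum_bprod[OF ad(3), symmetric] by (simp add: j_def case_prod_unfold)
  qed
  finally show ?thesis using ad by simp
qed

lemma Hmult_carrier: "Hmult n f g \<in> H_carrier n"
  by (auto simp: H_carrier_def Hmult_eq Hbasis_def)

lemma Hmult_add_left: "Hmult n (\<lambda>e. f e + f' e) g = (\<lambda>e. Hmult n f g e + Hmult n f' g e)"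
  by (simp add: Hmult_def distrib_right sum.distrib)

lemma Hmult_add_right: "Hmult n f (\<lambda>e. g e + g' e) = (\<lambda>e. Hmult n f g e + Hmult n f g' e)"
  by (simp add: Hmult_def distrib_right distrib_left sum.distrib)

lemma Hmult_zero_right: "Hmult n f (\<lambda>e. 0) = (\<lambda>e. 0)"
  by (simp add: Hmult_def)

lemma ddx_sum: "ddx S (\<lambda>v. \<Sum>b\<in>B. G b v) v = (\<Sum>b\<in>B. ddx S (G b) v)"
proof -
  have "unx k (\<lambda>v. \<Sum>b\<in>B. G b v) v = (\<Sum>b\<in>B. unx k (G b) v)" for k
    by (simp add: unx_def)
  then show ?thesis unfolding ddx_def by (simp add: sum.swap[of _ B])
qed

lemma mulx_sum: "mulx k (\<lambda>v. \<Sum>b\<in>B. G b v) v = (\<Sum>b\<in>B. mulx k (G b) v)"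
  by (simp add: mulx_def)

lemma ddx_zero: "ddx S (\<lambda>v. 0) v = 0" and mulx_zero: "mulx k (\<lambda>v. 0) v = 0"
  by (simp_all add: ddx_def unx_def mulx_def)

lemma H_ddx_Hmult:
  fixes f g :: "hbasis \<Rightarrow> 'r::comm_ring_1"
  assumes two: "\<And>x::'r. x + x = 0"
  shows "H_ddx n (Hmult n f g) = (\<lambda>e. Hmult n (H_ddx n f) g e + Hmult n f (H_ddx n g) e)"
proof
  fix e :: hbasis
  obtain a d v where e: "e = (a, d, v)" by (metis prod.exhaust)
  have "H_ddx n (Hmult n f g) e = (if v \<in> labs (circles n a d) then
      if a \<in> Cn n \<and> d \<in> Cn n
      then \<Sum>b\<in>Cn n. ddx (circles n a d) (gluing.glue_prod n a b d (\<lambda>v. f (a, b, v)) (\<lambda>w. g (b, d, w))) v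
      else 0 else 0)"
    unfolding e H_ddx_def Hmult_eq prod.case ddx_restrict
    by (cases "a \<in> Cn n"; cases "d \<in> Cn n"; simp add: ddx_sum ddx_zero)
  also have "\<dots> = (if v \<in> labs (circles n a d) then
      if a \<in> Cn n \<and> d \<in> Cn n
      then \<Sum>b\<in>Cn n. gluing.glue_prod n a b d (\<lambda>v. H_ddx n f (a, b, v)) (\<lambda>w. g (b, d, w)) v
        + gluing.glue_prod n a b d (\<lambda>v. f (a, b, v)) (\<lambda>w. H_ddx n g (b, d, w)) v
      else 0 else 0)"
    by (intro if_cong sum.cong refl)
      (simp add: gluing.ddx_glue_prod[OF gluing.intro two] H_ddx_def)
  finally show "H_ddx n (Hmult n f g) e = Hmult n (H_ddx n f) g e + Hmult n f (H_ddx n g) e"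
    unfolding e Hmult_eq by (simp add: sum.distrib)
qed

lemma H_mulx_Hmult:
  fixes f g :: "hbasis \<Rightarrow> 'r::comm_ring_1"
  assumes n: "1 \<le> n"
  shows "H_mulx n (Hmult n f g) = Hmult n (H_mulx n f) g" "H_mulx n (Hmult n f g) = Hmult n f (H_mulx n g)"
proof -
  have *: "H_mulx n (Hmult n f g) (a, d, v) = (if v \<in> labs (circles n a d) then
      if a \<in> Cn n \<and> d \<in> Cn n
      then \<Sum>b\<in>Cn n. mulx (kappa0 n a d) (gluing.glue_prod n a b d (\<lambda>v. f (a, b, v)) (\<lambda>w. g (b, d, w))) v
      else 0 else 0)" for a d v
    unfolding H_mulx_def Hmult_eq prod.case mulx_restrict[OF kappa0_in_circles[OF n]]
    by (cases "a \<in> Cn n"; cases "d \<in> Cn n"; simp add: mulx_sum mulx_zero)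
  show "H_mulx n (Hmult n f g) = Hmult n (H_mulx n f) g"
  proof (intro ext, clarify)
    fix a d v
    show "H_mulx n (Hmult n f g) (a, d, v) = Hmult n (H_mulx n f) g (a, d, v)"
      unfolding * Hmult_eq by (intro if_cong sum.cong refl)
        (simp add: gluing.mulx_glue_prod(1)[OF gluing.intro n] H_mulx_def)
  qed
  show "H_mulx n (Hmult n f g) = Hmult n f (H_mulx n g)"
  proof (intro ext, clarify)
    fix a d v
    show "H_mulx n (Hmult n f g) (a, d, v) = Hmult n f (H_mulx n g) (a, d, v)"
      unfolding * Hmult_eq by (intro if_cong sum.cong refl)
        (simp add: gluing.mulx_glue_prod(2)[OF gluing.intro n] H_mulx_def)
  qed
qed

lemma H_mulx_add: "H_mulx n (\<lambda>e. f e + g e) = (\<lambda>e. H_mulx n f e + H_mulx n g e)"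
  by (auto simp: H_mulx_def mulx_def)

lemma H_mulx_mulx: "H_mulx n (H_mulx n f) = (\<lambda>e. 0)"
  by (auto simp: H_mulx_def mulx_def)

lemma H_ddx_mulx:
  fixes f :: "hbasis \<Rightarrow> 'r::comm_ring_1"
  assumes two: "\<And>x::'r. x + x = 0" and n: "1 \<le> n"
  shows "H_ddx n (H_mulx n f) = (\<lambda>e. f e + H_mulx n (H_ddx n f) e)"
proof (intro ext, clarify)
  fix a b v
  let ?k = "kappa0 n a b" and ?S = "circles n a b" and ?f = "\<lambda>v. f (a, b, v)"
  have k: "?k \<in> ?S" using n by (rule kappa0_in_circles)
  have 1: "unx \<kappa> (mulx ?k ?f) v = mulx ?k (unx \<kappa> ?f) v" if "\<kappa> \<in> ?S - {?k}" for \<kappa>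
    using that by (auto simp: unx_def mulx_def fun_upd_twist)
  \<comment> \<open>On the marked factor \<open>D X\<close> fixes 1 and kills \<open>x\<close>,
    while \<open>X D\<close> does the opposite, so they add up to the identity; \<open>two\<close>
    moves one of them across.\<close>
  have 2: "unx ?k (mulx ?k ?f) v = f (a, b, v) + mulx ?k (unx ?k ?f) v"
    by (auto simp: unx_def mulx_def fun_upd_idem two)
  have "mulx ?k (ddx ?S ?f) v = (\<Sum>\<kappa>\<in>?S. mulx ?k (unx \<kappa> ?f) v)"
    unfolding ddx_def by (simp add: mulx_sum)
  also have "\<dots> = mulx ?k (unx ?k ?f) v + (\<Sum>\<kappa>\<in>?S - {?k}. mulx ?k (unx \<kappa> ?f) v)"
    using k by (simp add: sum.remove finite_circles)
  finally have 3: "mulx ?k (ddx ?S ?f) v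
    = mulx ?k (unx ?k ?f) v + (\<Sum>\<kappa>\<in>?S - {?k}. mulx ?k (unx \<kappa> ?f) v)" .
  have "ddx ?S (mulx ?k ?f) v = unx ?k (mulx ?k ?f) v + (\<Sum>\<kappa>\<in>?S - {?k}. unx \<kappa> (mulx ?k ?f) v)"
    unfolding ddx_def using k by (simp add: sum.remove finite_circles)
  also have "\<dots> = f (a, b, v) + mulx ?k (ddx ?S ?f) v"
    unfolding 2 3 using 1 by (simp add: add.assoc)
  finally show "H_ddx n (H_mulx n f) (a, b, v) = f (a, b, v) + H_mulx n (H_ddx n f) (a, b, v)"
    by (simp add: H_ddx_def H_mulx_def)
qed

text \<open>Apply \<open>X\<close> to \<open>D X = 1 + X D\<close> and use
  \<open>X X = 0\<close>.\<close>

lemma H_mulx_ddx_mulx: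
  fixes f :: "hbasis \<Rightarrow> 'r::comm_ring_1"
  assumes two: "\<And>x::'r. x + x = 0" and n: "1 \<le> n"
  shows "H_mulx n (H_ddx n (H_mulx n f)) = H_mulx n f"
  unfolding H_ddx_mulx[OF two n] H_mulx_add H_mulx_mulx by simp

text \<open>Applying \<open>D X = 1 + X D\<close> to \<open>D X f\<close> gives
  \<open>D X D X f = D X f + X D D X f\<close>. The left side is \<open>D X f\<close> because
  \<open>X D X = X\<close>, and cancelling leaves the claim.\<close>

lemma H_mulx_ddx_ddx_mulx:
  fixes f :: "hbasis \<Rightarrow> 'r::comm_ring_1"
  assumes two: "\<And>x::'r. x + x = 0" and n: "1 \<le> n"
  shows "H_mulx n (H_ddx n (H_ddx n (H_mulx n f))) = (\<lambda>e. 0)"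
proof -
  have "H_ddx n (H_mulx n (H_ddx n (H_mulx n f))) = (\<lambda>e. H_ddx n (H_mulx n f) e + H_mulx n (H_ddx n (H_ddx n (H_mulx n f))) e)"
    by (rule H_ddx_mulx[OF two n])
  then show ?thesis unfolding H_mulx_ddx_mulx[OF two n] by (simp add: fun_eq_iff)
qed

text \<open>The factors are the images of \<open>f1 \<otimes> 1 + fx \<otimes> x\<close> and
  \<open>g1 \<otimes> 1 + gx \<otimes> x\<close>. The term in \<open>fx\<close> and
  \<open>gx\<close> vanishes by \<open>X X = 0\<close>, just as \<open>x x = 0\<close> in
  \<open>A\<close>.\<close>

lemma Hmult_lam_parts:
  fixes f1 fx g1 gx :: "hbasis \<Rightarrow> 'r::comm_ring_1"
  assumes two: "\<And>x::'r. x + x = 0" and n: "1 \<le> n"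
  shows "Hmult n (\<lambda>e. H_ddx n (H_mulx n f1) e + H_mulx n fx e) (\<lambda>e. H_ddx n (H_mulx n g1) e + H_mulx n gx e)
    = (\<lambda>e. H_ddx n (H_mulx n (Hmult n f1 g1)) e
        + H_mulx n (\<lambda>e. Hmult n f1 gx e + Hmult n fx g1 e) e)"
proof -
  note XM = H_mulx_Hmult[OF n]
  note XDX = H_mulx_ddx_mulx[OF two n]
  let ?M = "Hmult n" and ?D = "H_ddx n" and ?X = "H_mulx n"
  \<comment> \<open>\<open>X\<close> is carried across the product to the other factor, where
    \<open>X D X\<close> collapses to \<open>X\<close>; the facts below repeat this pattern.\<close>
  have "?M (?X f1) (?D (?X g1)) = ?X (?M f1 g1)"
    unfolding XM(1)[symmetric] unfolding XM(2) XDX ..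
  moreover have "?M (?X f1) (?D (?D (?X g1))) = (\<lambda>e. 0)"
    unfolding XM(1)[symmetric] unfolding XM(2) H_mulx_ddx_ddx_mulx[OF two n] Hmult_zero_right ..
  ultimately have "?M (?D (?X f1)) (?D (?X g1)) = ?D (?X (?M f1 g1))"
    using H_ddx_Hmult[OF two, of n "?X f1" "?D (?X g1)"] by simp
  moreover have "?M (?D (?X f1)) (?X gx) = ?X (?M f1 gx)"
    unfolding XM(2)[symmetric] unfolding XM(1) XDX ..
  moreover have "?M (?X fx) (?D (?X g1)) = ?X (?M fx g1)"
    unfolding XM(1)[symmetric] unfolding XM(2) XDX ..
  moreover have "?M (?X fx) (?X gx) = (\<lambda>e. 0)"
    unfolding XM(2)[symmetric] unfolding XM(1) H_mulx_mulx by (simp add: Hmult_def)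
  ultimately show ?thesis
    unfolding Hmult_add_left Hmult_add_right H_mulx_add by (simp add: algebra_simps)
qed

section \<open>The map \<open>lam\<close> in terms of \<open>D\<close> and \<open>X\<close>, and its
  inverse\<close>

lemma TA_carrier_D: "F \<in> TA_carrier n \<Longrightarrow> e \<notin> Hred_basis n \<Longrightarrow> F (e, s) = 0"
  by (cases e) (auto simp: TA_carrier_def TA_basis_def)

lemma TA_part_carrier: "F \<in> TA_carrier n \<Longrightarrow> (\<lambda>e. F (e, s)) \<in> H_carrier n"
  by (auto simp: H_carrier_def Hred_basis_iff intro: TA_carrier_D)

lemma sum_TA_basis: "(\<Sum>t\<in>TA_basis n. h t) = (\<Sum>e\<in>Hred_basis n. h (e, L1) + h (e, Lx))"
proof -
  have "(\<Sum>t\<in>TA_basis n. h t) = (\<Sum>e\<in>Hred_basis n. \<Sum>s\<in>UNIV. h (e, s))"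
    unfolding TA_basis_def by (simp add: sum.cartesian_product)
  then show ?thesis unfolding UNIV_lab by simp
qed

text \<open>Each summand over \<open>\<kappa>\<close> turns \<open>x\<close> into 1 at an unmarked
  circle and 1 into \<open>x\<close> at the marked one, which is \<open>X D\<close>. The marked
  circle adds nothing to \<open>D\<close> here, since \<open>F\<close> lives on labellings with
  marked label 1.\<close>

lemma lam_eq:
  fixes F :: "hbasis \<times> lab \<Rightarrow> 'r::comm_ring_1"
  assumes F: "F \<in> TA_carrier n"
  shows "lam n F = (\<lambda>e. F (e, L1) + H_mulx n (H_ddx n (\<lambda>e. F (e, L1))) e + H_mulx n (\<lambda>e. F (e, Lx)) e)"
proof (intro ext, clarify)
  fix a b :: matching and v :: "nat set \<Rightarrow> lab"
  let ?k = "kappa0 n a b"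
  let ?B = "Hred_basis n"
  let ?e = "(a, b, v)"
  \<comment> \<open>Valid for every \<open>e0\<close>, since \<open>F\<close> vanishes off the
    reduced basis.\<close>
  have pick: "(\<Sum>e\<in>?B. if e = e0 then F (e, s) else 0) = F (e0, s)" for e0 s
    using TA_carrier_D[OF F] finite_Hred_basis by (auto simp: sum.delta')
  have "(\<Sum>e\<in>?B. F (e, Lx) * lam_basis n (e, Lx) ?e)
      = (\<Sum>e\<in>?B. if v ?k = Lx then if e = (a, b, v(?k := L1)) then F (e, Lx) else 0 else 0)"
  proof (rule sum.cong[OF refl], clarify)
    fix a' b' v' assume "(a', b', v') \<in> ?B"
    then have "v' (kappa0 n a' b') = L1" by (simp add: Hred_basis_iff)
    then have "?e = (a', b', v'(kappa0 n a' b' := Lx)) \<longleftrightarrow>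
        v ?k = Lx \<and> (a', b', v') = (a, b, v(?k := L1))" by auto
    then show "F ((a', b', v'), Lx) * lam_basis n ((a', b', v'), Lx) ?e =
        (if v ?k = Lx then if (a', b', v') = (a, b, v(?k := L1)) then F ((a', b', v'), Lx) else 0 else 0)"
      by (simp add: lam_basis_def delta_def)
  qed
  also have "\<dots> = H_mulx n (\<lambda>e. F (e, Lx)) ?e"
    by (simp add: pick H_mulx_def mulx_def)
  finally have x: "(\<Sum>e\<in>?B. F (e, Lx) * lam_basis n (e, Lx) ?e) = H_mulx n (\<lambda>e. F (e, Lx)) ?e" .
  let ?S = "circles n a b - {?k}"
  \<comment> \<open>The only labelling whose summand at \<open>\<kappa>\<close> can be
    \<open>v\<close>: it undoes the exchange of labels between \<open>\<kappa>\<close> and the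
    marked circle.\<close>
  let ?ek = "\<lambda>\<kappa>. (a, b, v(?k := L1, \<kappa> := Lx))"
  have "(\<Sum>e\<in>?B. F (e, L1) * lam_basis n (e, L1) ?e)
      = (\<Sum>e\<in>?B. (if e = ?e then F (e, L1) else 0) + (\<Sum>\<kappa>\<in>?S.
          if v ?k = Lx \<and> v \<kappa> = L1 then if e = ?ek \<kappa> then F (e, L1) else 0 else 0))"
  proof (rule sum.cong[OF refl], clarify)
    fix a' b' v' assume "(a', b', v') \<in> ?B"
    then have k: "v' (kappa0 n a' b') = L1" by (simp add: Hred_basis_iff)
    let ?k' = "kappa0 n a' b'"
    have "(\<Sum>\<kappa>\<in>{\<kappa> \<in> circles n a' b' - {?k'}. v' \<kappa> = Lx}. delta (a', b', v'(?k' := Lx, \<kappa> := L1)) ?e)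
      = (\<Sum>\<kappa>\<in>?S. if v ?k = Lx \<and> v \<kappa> = L1 then if (a', b', v') = ?ek \<kappa> then 1 else 0 else (0::'r))"
    proof (cases "a' = a \<and> b' = b")
      case True
      have "(if v' \<kappa> = Lx then delta (a, b, v'(?k := Lx, \<kappa> := L1)) ?e else (0::'r))
        = (if v ?k = Lx \<and> v \<kappa> = L1 then if v' = v(?k := L1, \<kappa> := Lx) then 1 else 0 else 0)"
        if "\<kappa> \<in> ?S" for \<kappa>
      proof -
        have "v ?k = Lx \<and> v \<kappa> = L1 \<and> v' = v(?k := L1, \<kappa> := Lx)"
          if "v' \<kappa> = Lx" "v = v'(?k := Lx, \<kappa> := L1)"
          using that(1) k True \<open>\<kappa> \<in> ?S\<close> unfolding that(2) by (auto simp: fun_eq_iff)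
        moreover have "v' \<kappa> = Lx \<and> v = v'(?k := Lx, \<kappa> := L1)"
          if "v ?k = Lx" "v \<kappa> = L1" "v' = v(?k := L1, \<kappa> := Lx)"
          using that(1,2) \<open>\<kappa> \<in> ?S\<close> unfolding that(3) by (auto simp: fun_eq_iff)
        ultimately show ?thesis unfolding delta_def prod.inject by (smt (verit))
      qed
      note * = this
      have fS: "finite ?S" by (simp add: finite_circles)
      have aa: "a' = a" "b' = b" using True by auto
      show ?thesis
        unfolding aa sum.inter_filter[OF fS] prod.inject by (intro sum.cong refl) (simp add: *)
    next
      case False
      then show ?thesis by (subst (1 2) sum.neutral) (auto simp: delta_def)
    qed
    moreover have "delta (a', b', v') ?e = (if (a', b', v') = ?e then 1 else 0 :: 'r)"
      by (auto simp: delta_def)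
    ultimately have lb: "lam_basis n ((a', b', v'), L1) ?e = (if (a', b', v') = ?e then 1 else 0) +
        (\<Sum>\<kappa>\<in>?S. if v ?k = Lx \<and> v \<kappa> = L1 then if (a', b', v') = ?ek \<kappa> then 1 else 0 else (0::'r))"
      by (simp only: lam_basis_def prod.case lab.case)
    show "F ((a', b', v'), L1) * lam_basis n ((a', b', v'), L1) ?e =
        (if (a', b', v') = ?e then F ((a', b', v'), L1) else 0) + (\<Sum>\<kappa>\<in>?S.
          if v ?k = Lx \<and> v \<kappa> = L1 then if (a', b', v') = ?ek \<kappa> then F ((a', b', v'), L1) else 0 else 0)"
      unfolding lb distrib_left sum_distrib_left
      by (intro arg_cong2[of _ _ _ _ "(+)"] sum.cong refl) simp_all
  qed
  also have "\<dots> = F (?e, L1) + (\<Sum>\<kappa>\<in>?S. \<Sum>e\<in>?B.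
          if v ?k = Lx \<and> v \<kappa> = L1 then if e = ?ek \<kappa> then F (e, L1) else 0 else 0)"
    by (simp only: sum.distrib pick sum.swap[of _ ?S])
  also have "\<dots> = F (?e, L1) + (\<Sum>\<kappa>\<in>?S. if v ?k = Lx \<and> v \<kappa> = L1 then F (?ek \<kappa>, L1) else 0)"
    by (intro arg_cong2[of _ _ _ _ "(+)"] sum.cong refl) (auto simp: pick)
  also have "(\<Sum>\<kappa>\<in>?S. if v ?k = Lx \<and> v \<kappa> = L1 then F (?ek \<kappa>, L1) else 0)
      = H_mulx n (H_ddx n (\<lambda>e. F (e, L1))) ?e"
  proof (cases "v ?k = Lx")
    case True
    \<comment> \<open>The marked circle drops out of \<open>D\<close>: its term evaluates
      \<open>F\<close> at a labelling with marked label \<open>x\<close>.\<close>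
    have "unx ?k (\<lambda>v. F ((a, b, v), L1)) (v(?k := L1)) = 0"
      using TA_carrier_D[OF F] by (simp add: unx_def Hred_basis_iff)
    then have "H_mulx n (H_ddx n (\<lambda>e. F (e, L1))) ?e = (\<Sum>\<kappa>\<in>?S. unx \<kappa> (\<lambda>v. F ((a, b, v), L1)) (v(?k := L1)))"
      using True unfolding H_mulx_def H_ddx_def mulx_def ddx_def
      by (auto simp: finite_circles intro!: sum.mono_neutral_right)
    also have "\<dots> = (\<Sum>\<kappa>\<in>?S. if v ?k = Lx \<and> v \<kappa> = L1 then F (?ek \<kappa>, L1) else 0)"
      using True by (intro sum.cong) (auto simp: unx_def)
    finally show ?thesis ..
  qed (auto simp: H_mulx_def mulx_def)
  finally have 1: "(\<Sum>e\<in>?B. F (e, L1) * lam_basis n (e, L1) ?e)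
    = F (?e, L1) + H_mulx n (H_ddx n (\<lambda>e. F (e, L1))) ?e" .
  show "lam n F ?e = F (?e, L1) + H_mulx n (H_ddx n (\<lambda>e. F (e, L1))) ?e + H_mulx n (\<lambda>e. F (e, Lx)) ?e"
    unfolding lam_def sum_TA_basis sum.distrib x 1 ..
qed

lemma lam_apply_L1:
  assumes "F \<in> TA_carrier n" "v (kappa0 n a b) = L1"
  shows "lam n F (a, b, v) = F ((a, b, v), L1)"
  using assms by (simp add: lam_eq H_mulx_def mulx_def)

lemma lam_apply_Lx:
  assumes "F \<in> TA_carrier n" "v (kappa0 n a b) = L1"
  shows "lam n F (a, b, v(kappa0 n a b := Lx)) = H_ddx n (\<lambda>e. F (e, L1)) (a, b, v) + F ((a, b, v), Lx)"
  using assms TA_carrier_D[OF assms(1), of "(a, b, v(kappa0 n a b := Lx))"]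
  by (simp add: lam_eq H_mulx_def mulx_def Hred_basis_iff fun_upd_idem)

text \<open>By \<open>lam_apply_L1\<close> the coefficients with marked label 1 are those of the
  \<open>1\<close>-part of \<open>F\<close>; by \<open>lam_apply_Lx\<close> the others are those of
  the \<open>x\<close>-part, shifted by \<open>D\<close> of the \<open>1\<close>-part. The inverse
  subtracts this shift.\<close>

definition lam_inv :: "nat \<Rightarrow> (hbasis \<Rightarrow> 'r::comm_ring_1) \<Rightarrow> hbasis \<times> lab \<Rightarrow> 'r" where
  "lam_inv n h = (\<lambda>((a, b, v), s). if (a, b, v) \<in> Hred_basis n
     then (case s of L1 \<Rightarrow> h (a, b, v)
       | Lx \<Rightarrow> h (a, b, v(kappa0 n a b := Lx)) - H_ddx n (\<lambda>e. if e \<in> Hred_basis n then h e else 0) (a, b, v))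
     else 0)"

lemma lam_inv_carrier: "lam_inv n h \<in> TA_carrier n"
  by (auto simp: TA_carrier_def TA_basis_def lam_inv_def)

lemma lam_carrier: "1 \<le> n \<Longrightarrow> F \<in> TA_carrier n \<Longrightarrow> lam n F \<in> H_carrier n"
proof -
  assume n: "1 \<le> n" and F: "F \<in> TA_carrier n"
  have "f \<in> H_carrier n \<Longrightarrow> g \<in> H_carrier n \<Longrightarrow> (\<lambda>e. f e + g e) \<in> H_carrier n" for f g :: "hbasis \<Rightarrow> 'a"
    by (simp add: H_carrier_def)
  then show ?thesis unfolding lam_eq[OF F]
    by (simp add: H_mulx_carrier[OF n] H_ddx_carrier TA_part_carrier[OF F])
qed

lemma bij_betw_lam:
  assumes n: "1 \<le> n"
  shows "bij_betw (lam n :: (hbasis \<times> lab \<Rightarrow> 'r::comm_ring_1) \<Rightarrow> _) (TA_carrier n) (H_carrier n)"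
proof (rule bij_betw_byWitness[where f' = "lam_inv n"]; (intro ballI)?)
  show "lam n ` TA_carrier n \<subseteq> H_carrier n" using lam_carrier[OF n] by auto
  show "lam_inv n ` H_carrier n \<subseteq> TA_carrier n" using lam_inv_carrier by auto
next
  fix F :: "hbasis \<times> lab \<Rightarrow> 'r" assume F: "F \<in> TA_carrier n"
  have 1: "(\<lambda>e. if e \<in> Hred_basis n then lam n F e else 0) = (\<lambda>e. F (e, L1))"
    using TA_carrier_D[OF F] lam_apply_L1[OF F] by (auto simp: Hred_basis_iff)
  show "lam_inv n (lam n F) = F"
  proof (intro ext, clarify)
    fix a b v s
    show "lam_inv n (lam n F) ((a, b, v), s) = F ((a, b, v), s)"
      using TA_carrier_D[OF F] lam_apply_L1[OF F] lam_apply_Lx[OF F]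
      by (cases s) (auto simp: lam_inv_def 1 Hred_basis_iff)
  qed
next
  fix h :: "hbasis \<Rightarrow> 'r" assume h: "h \<in> H_carrier n"
  note c = lam_inv_carrier[of n h]
  have 1: "(\<lambda>e. lam_inv n h (e, L1)) = (\<lambda>e. if e \<in> Hred_basis n then h e else 0)"
    by (auto simp: lam_inv_def)
  show "lam n (lam_inv n h) = h"
  proof (intro ext, clarify)
    fix a b v
    let ?k = "kappa0 n a b"
    show "lam n (lam_inv n h) (a, b, v) = h (a, b, v)"
    proof (cases "(a, b, v) \<in> Hbasis n")
      case False
      then show ?thesis using lam_carrier[OF n c] h by (auto simp: H_carrier_def)
    next
      case True
      show ?thesis
      proof (cases "v ?k = L1")
        case L1: True
        then show ?thesis
          using True by (subst lam_apply_L1[OF c]) (simp_all add: lam_inv_def Hred_basis_iff)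
      next
        case False
        then have v: "v = (v(?k := L1))(?k := Lx)" by (simp add: fun_upd_idem)
        have "(a, b, v(?k := L1)) \<in> Hred_basis n"
          using True n by (simp add: Hred_basis_iff Hbasis_upd kappa0_in_circles)
        then have "lam n (lam_inv n h) (a, b, (v(?k := L1))(?k := Lx)) = h (a, b, (v(?k := L1))(?k := Lx))"
          by (subst lam_apply_Lx[OF c]) (auto simp: 1, simp add: lam_inv_def)
        then show ?thesis using v by simp
      qed
    qed
  qed
qed

section \<open>The tensor product multiplication, and multiplicativity of \<open>lam\<close>\<close>

lemma Hmult_delta:
  assumes "e1 \<in> Hbasis n" "e2 \<in> Hbasis n"
  shows "Hmult n (delta e1) (delta e2) = bprod n e1 e2"
proof
  fix e
  have "Hmult n (delta e1) (delta e2) e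
    = (\<Sum>x\<in>Hbasis n. if x = e1 then \<Sum>y\<in>Hbasis n. if y = e2 then bprod n e1 e2 e else 0 else 0)"
    unfolding Hmult_def by (intro sum.cong refl) (auto simp: delta_def intro!: sum.cong)
  then show "Hmult n (delta e1) (delta e2) e = bprod n e1 e2 e"
    using assms by (simp add: sum.delta' finite_Hbasis)
qed

lemma Hmult_parts:
  assumes "F \<in> TA_carrier n" "G \<in> TA_carrier n"
  shows "Hmult n (\<lambda>e. F (e, s)) (\<lambda>e. G (e, t)) e =
    (\<Sum>e1\<in>Hred_basis n. \<Sum>e2\<in>Hred_basis n. F (e1, s) * G (e2, t) * bprod n e1 e2 e)"
proof -
  have sub: "Hred_basis n \<subseteq> Hbasis n" by (auto simp: Hred_basis_def)
  have "Hmult n (\<lambda>e. F (e, s)) (\<lambda>e. G (e, t)) e =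
      (\<Sum>e1\<in>Hred_basis n. \<Sum>e2\<in>Hbasis n. F (e1, s) * G (e2, t) * bprod n e1 e2 e)"
    unfolding Hmult_def
    using TA_carrier_D[OF assms(1)] by (intro sum.mono_neutral_right finite_Hbasis sub) auto
  also have "\<dots> = (\<Sum>e1\<in>Hred_basis n. \<Sum>e2\<in>Hred_basis n. F (e1, s) * G (e2, t) * bprod n e1 e2 e)"
    using TA_carrier_D[OF assms(2)]
    by (intro sum.cong refl sum.mono_neutral_right finite_Hbasis sub) auto
  finally show ?thesis .
qed

lemma TA_mult_eq:
  fixes F G :: "hbasis \<times> lab \<Rightarrow> 'r::comm_ring_1"
  assumes "F \<in> TA_carrier n" "G \<in> TA_carrier n"
  shows "TA_mult n F G (e, L1) =
      (if e \<in> Hred_basis n then Hmult n (\<lambda>e. F (e, L1)) (\<lambda>e. G (e, L1)) e else 0)"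
    and "TA_mult n F G (e, Lx) = (if e \<in> Hred_basis n then
        Hmult n (\<lambda>e. F (e, L1)) (\<lambda>e. G (e, Lx)) e + Hmult n (\<lambda>e. F (e, Lx)) (\<lambda>e. G (e, L1)) e else 0)"
proof -
  have b: "Hred_mult n (delta e1) (delta e2) e = (if e \<in> Hred_basis n then bprod n e1 e2 e else (0::'r))"
    if "e1 \<in> Hred_basis n" "e2 \<in> Hred_basis n" for e1 e2
    using that by (auto simp: Hred_mult_def Hred_basis_def Hmult_delta)
  show "TA_mult n F G (e, L1) =
      (if e \<in> Hred_basis n then Hmult n (\<lambda>e. F (e, L1)) (\<lambda>e. G (e, L1)) e else 0)"
    unfolding Hmult_parts[OF assms] TA_mult_def prod.case sum_TA_basis
    by (auto simp: b intro!: sum.cong sum.neutral)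
  show "TA_mult n F G (e, Lx) = (if e \<in> Hred_basis n then
        Hmult n (\<lambda>e. F (e, L1)) (\<lambda>e. G (e, Lx)) e + Hmult n (\<lambda>e. F (e, Lx)) (\<lambda>e. G (e, L1)) e else 0)"
    unfolding Hmult_parts[OF assms] TA_mult_def prod.case sum_TA_basis sum.distrib[symmetric]
    by (auto simp: b sum.distrib[symmetric] intro!: sum.cong sum.neutral)
qed

lemma TA_mult_carrier: "TA_mult n F G \<in> TA_carrier n"
  by (auto simp: TA_carrier_def TA_basis_def TA_mult_def Hred_mult_def)

text \<open>\<open>X\<close> reads coefficients at marked label 1 only, so the truncation defining
  the reduced product is invisible after \<open>X\<close>. In \<open>lam_mult\<close> this replaces
  the reduced product by the product of the arc algebra.\<close>

lemma H_mulx_restrict: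
  assumes "1 \<le> n" "h \<in> H_carrier n"
  shows "H_mulx n (\<lambda>e. if e \<in> Hred_basis n then h e else 0) = H_mulx n h"
  using assms by (auto simp: H_mulx_def mulx_def Hred_basis_iff H_carrier_def fun_eq_iff)

lemma lam_eq_ddx_mulx:
  fixes F :: "hbasis \<times> lab \<Rightarrow> 'r::comm_ring_1"
  assumes "\<And>x::'r. x + x = 0" "1 \<le> n" "F \<in> TA_carrier n"
  shows "lam n F = (\<lambda>e. H_ddx n (H_mulx n (\<lambda>e. F (e, L1))) e + H_mulx n (\<lambda>e. F (e, Lx)) e)"
  using lam_eq[OF assms(3)] H_ddx_mulx[OF assms(1,2), of "\<lambda>e. F (e, L1)"] by simp

lemma lam_mult:
  fixes F G :: "hbasis \<times> lab \<Rightarrow> 'r::comm_ring_1"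
  assumes two: "\<And>x::'r. x + x = 0" and n: "1 \<le> n" and F: "F \<in> TA_carrier n" and G: "G \<in> TA_carrier n"
  shows "lam n (TA_mult n F G) = Hmult n (lam n F) (lam n G)"
proof -
  have "(\<lambda>e. Hmult n f g e + Hmult n f' g' e) \<in> H_carrier n" for f g f' g' :: "hbasis \<Rightarrow> 'r"
    using Hmult_carrier[of n f g] Hmult_carrier[of n f' g'] by (simp add: H_carrier_def)
  then show ?thesis
    unfolding lam_eq_ddx_mulx[OF two n TA_mult_carrier] TA_mult_eq[OF F G]
      lam_eq_ddx_mulx[OF two n F] lam_eq_ddx_mulx[OF two n G] Hmult_lam_parts[OF two n]
    by (simp add: H_mulx_restrict[OF n] Hmult_carrier)
qed

section \<open>Degrees\<close>

lemma hdeg_eq: "hdeg n (a, b, v) = (\<Sum>\<kappa>\<in>circles n a b. adeg (v \<kappa>)) - int n"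
proof -
  have "adeg s = (if s = L1 then 1 else 0) - (if s = Lx then 1 else 0)" for s by (cases s) auto
  then have "(\<Sum>\<kappa>\<in>circles n a b. adeg (v \<kappa>)) =
      (\<Sum>\<kappa>\<in>circles n a b. if v \<kappa> = L1 then 1 else 0) - (\<Sum>\<kappa>\<in>circles n a b. if v \<kappa> = Lx then 1 else 0)"
    by (simp add: sum_subtractf)
  then show ?thesis
    by (simp add: hdeg_def sum.inter_filter[OF finite_circles, symmetric])
qed

lemma hdeg_upd:
  assumes "\<kappa> \<in> circles n a b"
  shows "hdeg n (a, b, v(\<kappa> := s)) = hdeg n (a, b, v) - adeg (v \<kappa>) + adeg s"
  using assms by (simp add: hdeg_eq sum.remove[OF finite_circles assms])

lemma tdeg_eq: "tdeg n (e, s) = hdeg n e - 1 + adeg s"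
  by (cases e) (simp add: tdeg_def rdeg_def hdeg_def)

text \<open>\<open>X\<close> lowers the degree by 2 and \<open>D\<close> raises it by 2, so
  \<open>X D\<close> preserves it. The shift by 1 in \<open>rdeg\<close> cancels the degree of 1 in
  \<open>A\<close>, so \<open>e \<otimes> 1\<close> has the degree of \<open>e\<close> in the arc
  algebra and \<open>e \<otimes> x\<close> has 2 less.\<close>

lemma lam_hom:
  assumes n: "1 \<le> n" and F: "F \<in> TA_hom n k"
  shows "lam n F \<in> H_hom n k"
proof -
  have c: "F \<in> TA_carrier n" using F by (simp add: TA_hom_def)
  have deg: "hdeg n e - 1 + adeg s = k" if "F (e, s) \<noteq> 0" for e s
    using F that unfolding TA_hom_def tdeg_eq[symmetric] by blast
  have "hdeg n (a, b, v) = k" if nz: "lam n F (a, b, v) \<noteq> 0" for a b v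
  proof (cases "v (kappa0 n a b) = L1")
    case True
    then show ?thesis using nz deg[of "(a, b, v)" L1] by (simp add: lam_apply_L1[OF c])
  next
    case False
    let ?k = "kappa0 n a b"
    have k: "?k \<in> circles n a b" using n by (rule kappa0_in_circles)
    define u where "u = v(?k := L1)"
    have v: "v = u(?k := Lx)" and u: "u ?k = L1" using False by (simp_all add: u_def fun_upd_idem)
    have hv: "hdeg n (a, b, v) = hdeg n (a, b, u) - 2"
      unfolding v hdeg_upd[OF k] u by simp
    have "H_ddx n (\<lambda>e. F (e, L1)) (a, b, u) \<noteq> 0 \<or> F ((a, b, u), Lx) \<noteq> 0"
      using nz unfolding v lam_apply_Lx[where v = u, OF c, where a = a and b = b, OF u] by auto
    then show ?thesis
    proof
      assume "H_ddx n (\<lambda>e. F (e, L1)) (a, b, u) \<noteq> 0"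
      then obtain \<kappa> where \<kappa>: "\<kappa> \<in> circles n a b" "unx \<kappa> (\<lambda>v. F ((a, b, v), L1)) u \<noteq> 0"
        unfolding H_ddx_def ddx_def prod.case by (meson sum.neutral)
      then have "u \<kappa> = L1" "F ((a, b, u(\<kappa> := Lx)), L1) \<noteq> 0"
        by (auto simp: unx_def split: if_splits)
      then show ?thesis
        using deg[of "(a, b, u(\<kappa> := Lx))" L1] hdeg_upd[OF \<kappa>(1), of u Lx] hv by simp
    next
      assume "F ((a, b, u), Lx) \<noteq> 0"
      then show ?thesis using deg[of "(a, b, u)" Lx] hv by simp
    qed
  qed
  then show ?thesis using lam_carrier[OF n c] by (auto simp: H_hom_def)
qed

theorem theorem3p1:
  fixes n :: nat
  assumes "CHAR('r::comm_ring_1) = 2"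
    and "1 \<le> n"
  shows "bij_betw (lam n :: (hbasis \<times> lab \<Rightarrow> 'r) \<Rightarrow> (hbasis \<Rightarrow> 'r)) (TA_carrier n) (H_carrier n)
    \<and> (\<forall>F::hbasis \<times> lab \<Rightarrow> 'r \<in> TA_carrier n. \<forall>G \<in> TA_carrier n.
          lam n (\<lambda>t. F t + G t) = (\<lambda>e. lam n F e + lam n G e))
    \<and> (\<forall>c::'r. \<forall>F \<in> TA_carrier n. lam n (\<lambda>t. c * F t) = (\<lambda>e. c * lam n F e))
    \<and> (\<forall>F::hbasis \<times> lab \<Rightarrow> 'r \<in> TA_carrier n. \<forall>G \<in> TA_carrier n.
          lam n (TA_mult n F G) = Hmult n (lam n F) (lam n G))
    \<and> (\<forall>k. \<forall>F::hbasis \<times> lab \<Rightarrow> 'r \<in> TA_hom n k. lam n F \<in> H_hom n k)"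
proof -
  have "(2::'r) = 0" using of_nat_CHAR[where 'a = 'r] assms(1) by simp
  then have two: "x + x = 0" for x :: 'r by (metis mult_2 mult_zero_left)
  have add: "lam n (\<lambda>t. F t + G t) = (\<lambda>e. lam n F e + lam n G e)" for F G :: "hbasis \<times> lab \<Rightarrow> 'r"
    by (simp add: lam_def distrib_right sum.distrib)
  have scale: "lam n (\<lambda>t. c * F t) = (\<lambda>e. c * lam n F e)" for c :: 'r and F
    by (simp add: lam_def sum_distrib_left mult.assoc)
  show ?thesis
    by (intro conjI allI ballI add scale bij_betw_lam lam_mult two lam_hom assms(2))
qed

end
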